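(* Let $-3<\gamma\le1$ and let $k>\max\{3,3+\gamma\}$. Then for all $v\in\mathbb{R}^3$, $$I:=\int_{\mathbb{R}^3}\int_{\mathbb{S}^2}|v-v_*|^\gamma\frac{\langle v\rangle^k}{\langle v'\rangle^k}e^{-\frac12|v'_*|^2}\,d\sigma dv_*\le\frac{c}{k^{\frac{\gamma+3}{4}}}\langle v\rangle^\gamma+C_k\langle v\rangle^{\gamma-2},$$ for some constant $c>0$ independent of $k$ and some constant $C_k>0$ depending on $k$. Moreover, for any small $\epsilon>0$ and all $v\in\mathbb{R}^3$, $$J:=\int_{\mathbb{R}^3}\int_{\mathbb{S}^2}\mathbf{1}_{\{|v-v'|>\frac{\langle v\rangle}{\epsilon}\}\cup\{|v-v'|<\epsilon\langle v\rangle\}}\,|v-v_*|^\gamma\frac{\langle v\rangle^k}{\langle v'\rangle^k}e^{-\frac12|v'_*|^2}\,d\sigma dv_*\le C_{k,\epsilon}\langle v\rangle^\gamma,\qquad\lim_{\epsilon\to0}C_{k,\epsilon}=0,$$ where $C_{k,\epsilon}$ does not depend on $v$. Also, for all $v\in\mathbb{R}^3$, $$\int_{\mathbb{R}^3}\int_{\mathbb{S}^2}|v-v_*|^\gamma\frac{\langle v\rangle^k}{\langle v'\rangle^k}e^{-\frac12|v'_*|^2}\langle v'\rangle^{-2}\,d\sigma dv_*\le C_k\langle v\rangle^{\gamma-2}.$$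
   Context: $\langle v\rangle=(1+|v|^2)^{1/2}$; for $v,v_*\in\mathbb{R}^3$, $\sigma\in\mathbb{S}^2$: $v'=\frac{v+v_*}{2}+\frac{|v-v_*|}{2}\sigma$, $v'_*=\frac{v+v_*}{2}-\frac{|v-v_*|}{2}\sigma$. All constants may depend on $\gamma$ and are independent of $v$. *)

theory Defs
  imports "HOL-Analysis.Analysis"
begin

definition japanese :: "'a::real_normed_vector \<Rightarrow> real" where
  "japanese v = sqrt (1 + (norm v)\<^sup>2)"

definition post :: "real^3 \<Rightarrow> real^3 \<Rightarrow> real^3 \<Rightarrow> real^3" where
  "post v w \<sigma> = (1/2) *\<^sub>R (v + w) + (norm (v - w) / 2) *\<^sub>R \<sigma>"

definition post_star :: "real^3 \<Rightarrow> real^3 \<Rightarrow> real^3 \<Rightarrow> real^3" where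
  "post_star v w \<sigma> = (1/2) *\<^sub>R (v + w) - (norm (v - w) / 2) *\<^sub>R \<sigma>"

text \<open>
  The surface measure of the unit sphere of an \<open>n\<close>-dimensional space, given by the
  polar-coordinate identity: the surface area of \<open>A\<close> is \<open>n\<close> times the Lebesgue measure of the
  cone \<open>{r x | 0 < r < 1, x \<in> A}\<close>. Here \<^term>\<open>sgn x\<close> is \<open>x / norm x\<close>; it is not a unit
  vector at the origin, which is therefore removed from the ball.
\<close>
definition sphere_measure :: "'a::euclidean_space measure" where
  "sphere_measure =
     scale_measure (of_nat DIM('a))
       (distr (restrict_space lborel (ball 0 1 - {0})) (restrict_space borel (sphere 0 1)) sgn)"

lemma space_sphere_measure [simp]: "space sphere_measure = sphere 0 1"
  by (simp add: sphere_measure_def space_scale_measure space_restrict_space)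

lemma sets_sphere_measure [measurable_cong]:
  "sets sphere_measure = sets (restrict_space borel (sphere 0 1))"
  by (simp add: sphere_measure_def)

lemma measurable_sgn_sphere:
  "(sgn :: 'a::euclidean_space \<Rightarrow> 'a)
     \<in> restrict_space lborel (ball 0 1 - {0}) \<rightarrow>\<^sub>M restrict_space borel (sphere 0 1)"
proof (rule measurable_restrict_space2)
  show "(sgn :: 'a \<Rightarrow> 'a) \<in> space (restrict_space lborel (ball 0 1 - {0})) \<rightarrow> sphere 0 1"
    by (auto simp: space_restrict_space norm_sgn)
  have "(\<lambda>x::'a. x /\<^sub>R norm x) \<in> borel_measurable borel"
    by measurable
  then have "(sgn :: 'a \<Rightarrow> 'a) \<in> borel_measurable lborel"
    by (simp add: sgn_div_norm[abs_def])
  then show "(sgn :: 'a \<Rightarrow> 'a) \<in> restrict_space lborel (ball 0 1 - {0}) \<rightarrow>\<^sub>M borel"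
    by (rule measurable_restrict_space1)
qed

lemma emeasure_sphere_measure:
  "emeasure (sphere_measure :: (real^3) measure) (sphere 0 1) = ennreal (4 * pi)"
proof -
  let ?B = "ball 0 1 - {0} :: (real^3) set"
  let ?R = "restrict_space lborel ?B"
  have S: "sphere 0 1 \<in> sets (restrict_space borel (sphere 0 1 :: (real^3) set))"
    by (metis sets.top space_borel space_restrict_space inf_top.right_neutral)
  have pre: "sgn -` sphere 0 1 \<inter> space ?R = ?B"
    by (auto simp: space_restrict_space norm_sgn)
  have "emeasure (distr ?R (restrict_space borel (sphere 0 1)) sgn) (sphere 0 1) = emeasure ?R ?B"
    using emeasure_distr[OF measurable_sgn_sphere S] pre by simp
  also have "\<dots> = emeasure lborel ?B"
    by (rule emeasure_restrict_space) auto
  also have "\<dots> = emeasure lborel (ball 0 1 :: (real^3) set)"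
    by (subst emeasure_Diff) (auto simp: emeasure_lborel_ball_finite)
  also have "\<dots> = ennreal (4 / 3 * pi)"
    by (simp add: emeasure_ball unit_ball_vol_3)
  finally have "emeasure (sphere_measure :: (real^3) measure) (sphere 0 1)
      = 3 * ennreal (4 / 3 * pi)"
    by (simp add: sphere_measure_def)
  also have "\<dots> = ennreal (3 * (4 / 3 * pi))"
    by (subst ennreal_mult) auto
  finally show ?thesis
    by simp
qed

end

theory Submission
  imports Defs
begin

text \<open>
  For a fixed direction \<open>\<sigma>\<close>, use \<open>p = v - v'\<^sub>*\<close> instead of \<open>v\<^sub>*\<close> as integration variable. This is
  the Carleman representation in a form that needs no integration over planes: on the half space
  \<open>p \<bullet> \<sigma> > 0\<close> the map \<open>p \<mapsto> v - v\<^sub>*\<close> is injective, misses only a null set and has Jacobian \<open>4 / c\<^sup>2\<close>,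
  where \<open>c\<close> is the cosine of the angle between \<open>p\<close> and \<open>\<sigma>\<close> (half the deflection angle). Moreover
  \<open>|v - v\<^sub>*| = |p| / c\<close>, and \<open>y = v' - v\<close> is orthogonal to \<open>p\<close> with \<open>|y| = |p| tan \<alpha>\<close>, \<open>c = cos \<alpha>\<close>.
  So the integral becomes that of \<open>4 |p|\<^sup>\<gamma> c\<^bsup>-\<gamma>-2\<^esup> (\<langle>v\<rangle> / \<langle>v'\<rangle>)\<^sup>k\<close> against the Gaussian in \<open>z = v - p\<close>.

  The orthogonality gives \<open>v \<bullet> y = z \<bullet> y\<close>, hence \<open>\<langle>v'\<rangle>\<^sup>2 \<ge> \<langle>v\<rangle>\<^sup>2 - 2 |z| |y| + |y|\<^sup>2\<close>. If \<open>\<langle>v\<rangle>\<close> is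
  large compared with \<open>\<surd>k \<langle>z\<rangle>\<close>, then \<open>|p|\<close> is comparable to \<open>\<langle>v\<rangle>\<close>, and this lower bound makes
  \<open>(\<langle>v\<rangle> / \<langle>v'\<rangle>)\<^sup>k\<close> at most a constant times \<open>c\<close> to the power \<open>3 + (k - 3) / 8\<close>, with a constant that does
  not depend on \<open>k\<close> (lemma \<open>weight_ratio_le_cos_powr\<close>). Since \<open>\<gamma> \<le> 1\<close>, three of these powers absorb \<open>c\<^bsup>-\<gamma>-2\<^esup>\<close>, and the
  remaining power of the cosine has integral \<open>O(1/k)\<close> over the sphere (lemma \<open>nn_integral_sphere_cos_powr_le\<close>). This is better than the
  decay \<open>k\<close> to the power \<open>-(\<gamma> + 3) / 4\<close> that is claimed, because that exponent is at least \<open>-1\<close>.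

  In the complementary region \<open>\<langle>v\<rangle>\<close> is dominated by a multiple of \<open>\<langle>z\<rangle>\<close>, so part of the Gaussian pays
  for any power of \<open>\<langle>v\<rangle>\<close>. There, writing \<open>|p|\<^sup>\<gamma> c\<^bsup>-\<gamma>-2\<^esup> = |p|\<^sup>\<beta> |v - v\<^sub>*|\<^bsup>\<gamma>-\<beta>\<^esup> c\<^bsup>-\<beta>-2\<^esup>\<close> with some
  \<open>-3 < \<beta> \<le> -2\<close> below \<open>\<gamma>\<close> leaves the locally integrable singularity \<open>|p|\<^sup>\<beta>\<close> and no singularity in \<open>c\<close>;
  the factor \<open>|v - v\<^sub>*|\<^bsup>\<gamma>-\<beta>\<^esup>\<close> grows at most like \<open>\<langle>v'\<rangle>\<^bsup>\<gamma>-\<beta>\<^esup>\<close>, up to powers of \<open>\<langle>v\<rangle>\<close> and \<open>\<langle>z\<rangle>\<close>, and is absorbed by \<open>\<langle>v'\<rangle>\<^bsup>-k\<^esup>\<close>.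

  The weighted Gaussian integral of \<open>|p|\<^sup>b\<close> is of order \<open>\<langle>v\<rangle>\<^sup>b\<close> for every \<open>b > -3\<close>
  (lemma \<open>nn_integral_powr_gauss_le\<close>), which turns the pointwise bounds into the first estimate. For the second
  one let \<open>\<epsilon> \<le> 1/2\<close>. A jump \<open>|y| > \<langle>v\<rangle> / \<epsilon>\<close> forces \<open>\<langle>v\<rangle> / \<langle>v'\<rangle> \<le> 2 \<epsilon>\<close>, so that lowering \<open>k\<close> slightly gains a power
  of \<open>\<epsilon>\<close>; and \<open>|y| < \<epsilon> \<langle>v\<rangle>\<close> forces \<open>|p| < \<surd>\<epsilon> \<langle>v\<rangle>\<close> or \<open>tan \<alpha> \<le> \<surd>\<epsilon>\<close>, and both sets contribute little.
  The third estimate is the first one for \<open>k + 2\<close>.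
\<close>

section \<open>Carleman change of variables for a fixed scattering direction\<close>

text \<open>
  For nonnegative integrands the change of variables formula needs no integrability: if the right
  hand side is infinite there is nothing to show, and otherwise it provides the absolute
  integrability that the formula for signed integrands asks for. The function \<open>D\<close> extends the
  transformed integrand by zero and carries its measurability, about which the mere existence of the
  derivatives \<open>g'\<close> says nothing directly.
\<close>
lemma nn_integral_change_of_variables_le:
  fixes g :: "real^'n::{finite,wellorder} \<Rightarrow> real^'n::_" and F :: "real^'n::_ \<Rightarrow> real"
  assumes S: "S \<in> sets borel"
    and der: "\<And>x. x \<in> S \<Longrightarrow> (g has_derivative g' x) (at x within S)"
    and inj: "inj_on g S"
    and null: "negligible (- g ` S)"
    and F: "F \<in> borel_measurable borel" "\<And>y. 0 \<le> F y"
    and D: "D \<in> borel_measurable borel" "\<And>x. 0 \<le> D x" "\<And>x. x \<notin> S \<Longrightarrow> D x = 0"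
    and det: "\<And>x. x \<in> S \<Longrightarrow> \<bar>det (matrix (g' x))\<bar> * F (g x) = D x"
  shows "(\<integral>\<^sup>+ y. ennreal (F y) \<partial>lborel) \<le> (\<integral>\<^sup>+ x. ennreal (D x) \<partial>lborel)"
proof (cases "(\<integral>\<^sup>+ x. ennreal (D x) \<partial>lborel) = \<infinity>")
  case True
  then show ?thesis by simp
next
  case False
  have Dint: "integrable lborel D"
    using False D by (intro integrableI_nonneg) (auto simp: top.not_eq_extremum)
  have Dhi: "(D has_integral (integral\<^sup>L lborel D)) UNIV"
    using has_integral_integral_lborel[OF Dint] .
  \<comment> \<open>The formula for signed integrands is about vector-valued functions, so scalars are read in \<open>real^1\<close>.\<close>
  let ?J = "\<lambda>x. \<bar>det (matrix (g' x))\<bar> *\<^sub>R (vec (F (g x)) :: real^1)"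
  have eqS: "(\<lambda>x. if x \<in> S then \<bar>det (matrix (g' x))\<bar> * F (g x) else 0) = D"
    using D(3) det by auto
  have hi: "((\<lambda>x. \<bar>det (matrix (g' x))\<bar> * F (g x)) has_integral (integral\<^sup>L lborel D)) S"
    using Dhi has_integral_restrict_UNIV[of S "\<lambda>x. \<bar>det (matrix (g' x))\<bar> * F (g x)"]
    unfolding eqS by simp
  have ai: "(\<lambda>x. \<bar>det (matrix (g' x))\<bar> * F (g x)) absolutely_integrable_on S"
    by (rule nonnegative_absolutely_integrable_1) (use hi F in auto)
  have "?J absolutely_integrable_on S \<and> integral S ?J = vec (integral\<^sup>L lborel D)"
    using ai integral_unique[OF hi]
    by (simp add: absolutely_integrable_on_1_iff integral_on_1_eq)
  then have "(\<lambda>y. vec (F y) :: real^1) absolutely_integrable_on (g ` S)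
      \<and> integral (g ` S) (\<lambda>y. vec (F y) :: real^1) = vec (integral\<^sup>L lborel D)"
    using has_absolute_integral_change_of_variables[OF _ der inj, of "\<lambda>y. vec (F y) :: real^1"] S
    by auto
  then have R: "F absolutely_integrable_on (g ` S)" "integral (g ` S) F = integral\<^sup>L lborel D"
    by (simp_all add: absolutely_integrable_on_1_iff integral_on_1_eq)
  then have "(F has_integral (integral\<^sup>L lborel D)) (g ` S)"
    using set_lebesgue_integral_eq_integral(1)[OF R(1)] by (simp add: has_integral_iff)
  then have "(F has_integral (integral\<^sup>L lborel D)) UNIV"
  proof (rule iffD1[OF has_integral_spike_set_eq, rotated 2])
    show "negligible {x \<in> g ` S - UNIV. F x \<noteq> 0}" by simp
    show "negligible {x \<in> UNIV - g ` S. F x \<noteq> 0}"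
      by (rule negligible_subset[OF null]) blast
  qed
  then have "(\<integral>\<^sup>+ y. ennreal (F y) \<partial>lborel) = ennreal (integral\<^sup>L lborel D)"
    using F by (intro nn_integral_has_integral_lborel) auto
  also have "\<dots> = (\<integral>\<^sup>+ x. ennreal (D x) \<partial>lborel)"
    using Dint D by (simp add: nn_integral_eq_integral)
  finally show ?thesis by simp
qed

lemma axis_nth_if: "axis j (1::real) $ i = (if i = j then 1 else 0)"
  by (simp add: axis_def)

lemma det_id_plus_rank_one:
  fixes a b :: "real^3"
  shows "det (matrix (\<lambda>h. s *\<^sub>R h + (b \<bullet> h) *\<^sub>R a)) = s^2 * (s + a \<bullet> b)"
proof -
  have eq: "matrix (\<lambda>h. s *\<^sub>R h + (b \<bullet> h) *\<^sub>R a) = (\<chi> i j. (if i = j then s else 0) + b $ j * a $ i)"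
    by (auto simp: matrix_def vec_eq_iff inner_axis axis_nth_if)
  show ?thesis
    unfolding eq det_3
    by (simp add: inner_vec_def sum_3 power2_eq_square algebra_simps)
qed

text \<open>
  The relative velocity \<open>q = v - v\<^sub>*\<close> as a function of \<open>p = v - v'\<^sub>* = (q + |q| \<sigma>) / 2\<close>: taking squares and
  inner products with \<open>\<sigma>\<close> gives \<open>|p|\<^sup>2 = |q| (p \<bullet> \<sigma>)\<close>, so \<open>|q|\<close> and then \<open>q = 2 p - |q| \<sigma>\<close> are determined.
\<close>
definition rel_velocity :: "real^3 \<Rightarrow> real^3 \<Rightarrow> real^3" where
  "rel_velocity \<sigma> p = 2 *\<^sub>R p - ((norm p)\<^sup>2 / (p \<bullet> \<sigma>)) *\<^sub>R \<sigma>"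

lemma norm_rel_velocity:
  assumes "norm \<sigma> = 1" "p \<bullet> \<sigma> > 0"
  shows "norm (rel_velocity \<sigma> p) = (norm p)\<^sup>2 / (p \<bullet> \<sigma>)"
proof -
  have s: "\<sigma> \<bullet> \<sigma> = 1" using assms(1) by (simp add: dot_square_norm)
  have "(norm (rel_velocity \<sigma> p))\<^sup>2 = ((norm p)\<^sup>2 / (p \<bullet> \<sigma>))\<^sup>2"
    using assms(2) unfolding rel_velocity_def power2_norm_eq_inner
    by (simp add: inner_diff_left inner_diff_right s inner_commute[of \<sigma> p] power2_eq_square field_simps)
  then show ?thesis using assms(2) by (simp add: power2_eq_iff_nonneg)
qed

lemma rel_velocity_inverse:
  assumes "norm \<sigma> = 1" "p \<bullet> \<sigma> > 0"
  shows "(1/2) *\<^sub>R (rel_velocity \<sigma> p + norm (rel_velocity \<sigma> p) *\<^sub>R \<sigma>) = p"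
  using norm_rel_velocity[OF assms] by (simp add: rel_velocity_def)

text \<open>
  Only the ray spanned by \<open>-\<sigma>\<close> is missed: there \<open>q + |q| \<sigma>\<close> vanishes. Excluding the whole line keeps the
  exceptional set a subspace, which is visibly negligible.
\<close>
lemma rel_velocity_surj:
  assumes "norm \<sigma> = 1" "q \<notin> span {\<sigma>}"
  obtains p where "p \<bullet> \<sigma> > 0" "rel_velocity \<sigma> p = q"
proof
  let ?p = "(1/2) *\<^sub>R (q + norm q *\<^sub>R \<sigma>)"
  have s: "\<sigma> \<bullet> \<sigma> = 1" using assms(1) by (simp add: dot_square_norm)
  have ne: "\<bar>q \<bullet> \<sigma>\<bar> \<noteq> norm q * norm \<sigma>"
  proof
    assume "\<bar>q \<bullet> \<sigma>\<bar> = norm q * norm \<sigma>"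
    then have "norm q *\<^sub>R \<sigma> = norm \<sigma> *\<^sub>R q \<or> norm q *\<^sub>R \<sigma> = - norm \<sigma> *\<^sub>R q"
      using norm_cauchy_schwarz_abs_eq by blast
    then have "q = norm q *\<^sub>R \<sigma> \<or> q = (- norm q) *\<^sub>R \<sigma>" using assms(1) by auto
    then have "q \<in> span {\<sigma>}" by (metis span_base span_mul singletonI)
    with assms show False by simp
  qed
  have pos: "q \<bullet> \<sigma> + norm q > 0"
    using ne Cauchy_Schwarz_ineq2[of q \<sigma>] assms(1) by auto
  have ps: "?p \<bullet> \<sigma> = (q \<bullet> \<sigma> + norm q) / 2" by (simp add: inner_add_left s)
  show "?p \<bullet> \<sigma> > 0" using pos ps by simp
  have "(norm ?p)\<^sup>2 = norm q * (q \<bullet> \<sigma> + norm q) / 2"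
  proof -
    have "?p \<bullet> ?p = (q \<bullet> q + 2 * norm q * (q \<bullet> \<sigma>) + norm q * norm q) / 4"
      by (simp add: inner_add_left inner_add_right s inner_commute[of \<sigma> q] field_simps)
    moreover have "q \<bullet> q = norm q * norm q" by (simp add: dot_square_norm power2_eq_square)
    ultimately show ?thesis unfolding power2_norm_eq_inner by (simp add: field_simps)
  qed
  then have "(norm ?p)\<^sup>2 / (?p \<bullet> \<sigma>) = norm q" unfolding ps using pos by simp
  then show "rel_velocity \<sigma> ?p = q" by (simp add: rel_velocity_def)
qed

lemma has_derivative_rel_velocity:
  assumes "p \<bullet> \<sigma> > 0"
  shows "((\<lambda>p. v - rel_velocity \<sigma> p) has_derivative
     (\<lambda>h. (-2) *\<^sub>R h + (((2 / (p \<bullet> \<sigma>)) *\<^sub>R p - ((norm p)\<^sup>2 / (p \<bullet> \<sigma>)\<^sup>2) *\<^sub>R \<sigma>) \<bullet> h) *\<^sub>R \<sigma>)) (at p within S)"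
proof -
  let ?B = "\<lambda>h. ((p \<bullet> \<sigma>) * (2 * (p \<bullet> h)) - (p \<bullet> p) * (h \<bullet> \<sigma>)) / (p \<bullet> \<sigma>)\<^sup>2"
  have "((\<lambda>p. (p \<bullet> p) / (p \<bullet> \<sigma>)) has_derivative ?B) (at p within S)"
  proof (rule has_derivative_eq_rhs)
    show "((\<lambda>p. (p \<bullet> p) / (p \<bullet> \<sigma>)) has_derivative
        (\<lambda>h. ((p \<bullet> h + h \<bullet> p) * (p \<bullet> \<sigma>) - (p \<bullet> p) * (p \<bullet> 0 + h \<bullet> \<sigma>)) / ((p \<bullet> \<sigma>) * (p \<bullet> \<sigma>)))) (at p within S)"
      using assms by (intro has_derivative_divide' has_derivative_inner has_derivative_ident has_derivative_const) simp
  qed (simp add: fun_eq_iff inner_commute power2_eq_square mult.commute)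
  then have "((\<lambda>p. v - (2 *\<^sub>R p - ((p \<bullet> p) / (p \<bullet> \<sigma>)) *\<^sub>R \<sigma>)) has_derivative
     (\<lambda>h. 0 - (2 *\<^sub>R h - ?B h *\<^sub>R \<sigma>))) (at p within S)"
    by (intro has_derivative_diff has_derivative_const has_derivative_scaleR_left
        has_derivative_scaleR_right has_derivative_ident)
  moreover have "?B h = ((2 / (p \<bullet> \<sigma>)) *\<^sub>R p - ((norm p)\<^sup>2 / (p \<bullet> \<sigma>)\<^sup>2) *\<^sub>R \<sigma>) \<bullet> h" for h
    using assms by (simp add: inner_diff_left inner_commute[of h \<sigma>] dot_square_norm field_simps power2_eq_square)
  ultimately show ?thesis by (simp add: rel_velocity_def power2_norm_eq_inner)
qed

lemma det_rel_velocity: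
  fixes p \<sigma> :: "real^3"
  assumes "norm \<sigma> = 1" "p \<bullet> \<sigma> > 0"
  shows "\<bar>det (matrix (\<lambda>h. (-2) *\<^sub>R h + (((2 / (p \<bullet> \<sigma>)) *\<^sub>R p - ((norm p)\<^sup>2 / (p \<bullet> \<sigma>)\<^sup>2) *\<^sub>R \<sigma>) \<bullet> h) *\<^sub>R \<sigma>))\<bar>
     = 4 * (norm p)\<^sup>2 / (p \<bullet> \<sigma>)\<^sup>2"
proof -
  have s: "\<sigma> \<bullet> \<sigma> = 1" using assms(1) by (simp add: dot_square_norm)
  show ?thesis
    unfolding det_id_plus_rank_one[where s = "-2" and a = \<sigma> and b = "(2 / (p \<bullet> \<sigma>)) *\<^sub>R p - ((norm p)\<^sup>2 / (p \<bullet> \<sigma>)\<^sup>2) *\<^sub>R \<sigma>"] using assms(2)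
    by (simp add: inner_diff_right s inner_commute[of \<sigma> p] abs_mult)
qed

lemma nn_integral_rel_velocity_le:
  fixes F :: "real^3 \<Rightarrow> real"
  assumes s: "norm \<sigma> = 1" and F: "F \<in> borel_measurable borel" "\<And>y. 0 \<le> F y"
  shows "(\<integral>\<^sup>+ w. ennreal (F w) \<partial>lborel) \<le>
    (\<integral>\<^sup>+ p. ennreal (if p \<bullet> \<sigma> > 0 then 4 * (norm p)\<^sup>2 / (p \<bullet> \<sigma>)\<^sup>2 * F (v - rel_velocity \<sigma> p) else 0) \<partial>lborel)"
proof (rule nn_integral_change_of_variables_le)
  let ?S = "{p. p \<bullet> \<sigma> > 0}"
  show "?S \<in> sets borel" by measurable
  show "((\<lambda>p. v - rel_velocity \<sigma> p) has_derivative
     (\<lambda>h. (-2) *\<^sub>R h + (((2 / (p \<bullet> \<sigma>)) *\<^sub>R p - ((norm p)\<^sup>2 / (p \<bullet> \<sigma>)\<^sup>2) *\<^sub>R \<sigma>) \<bullet> h) *\<^sub>R \<sigma>)) (at p within ?S)"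
    if "p \<in> ?S" for p using that by (intro has_derivative_rel_velocity) simp
  show "inj_on (\<lambda>p. v - rel_velocity \<sigma> p) ?S"
  proof (rule inj_onI)
    fix p p' assume A: "p \<in> ?S" "p' \<in> ?S" "v - rel_velocity \<sigma> p = v - rel_velocity \<sigma> p'"
    then have "rel_velocity \<sigma> p = rel_velocity \<sigma> p'" by simp
    then show "p = p'" using rel_velocity_inverse[OF s] A by (metis mem_Collect_eq)
  qed
  show "negligible (- (\<lambda>p. v - rel_velocity \<sigma> p) ` ?S)"
  proof (rule negligible_subset)
    have "dim (span {\<sigma>}) < DIM(real^3)"
      using dim_le_card[of "{\<sigma>}"] by (simp add: dim_span order.strict_trans1)
    then have "negligible (span {\<sigma>})" by (rule negligible_lowdim[OF order.strict_trans1[rotated]]) (simp add: dim_span)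
    then show "negligible ((+) v ` span {\<sigma>})" by (rule negligible_translation)
    show "- (\<lambda>p. v - rel_velocity \<sigma> p) ` ?S \<subseteq> (+) v ` span {\<sigma>}"
    proof
      fix w assume w: "w \<in> - (\<lambda>p. v - rel_velocity \<sigma> p) ` ?S"
      have "v - w \<in> span {\<sigma>}"
      proof (rule ccontr)
        assume "v - w \<notin> span {\<sigma>}"
        from rel_velocity_surj[OF s this] obtain p where "p \<bullet> \<sigma> > 0" "rel_velocity \<sigma> p = v - w" .
        then have "w = v - rel_velocity \<sigma> p" by simp
        with w \<open>p \<bullet> \<sigma> > 0\<close> show False by blast
      qed
      then have "w - v \<in> span {\<sigma>}" by (metis minus_diff_eq span_neg)
      then show "w \<in> (+) v ` span {\<sigma>}" by (intro image_eqI[of _ _ "w - v"]) auto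
    qed
  qed
  show "(\<lambda>p. if p \<bullet> \<sigma> > 0 then 4 * (norm p)\<^sup>2 / (p \<bullet> \<sigma>)\<^sup>2 * F (v - rel_velocity \<sigma> p) else 0) \<in> borel_measurable borel"
    using F(1) unfolding rel_velocity_def by measurable
qed (use F det_rel_velocity[OF s] in auto)

section \<open>Integrals over the sphere and the exchange of the two integrations\<close>

lemma sets_punctured_ball [measurable]: "ball 0 1 - {0 :: 'a::euclidean_space} \<in> sets borel"
  by simp

lemma nn_integral_sphere_measure:
  fixes f :: "'a::euclidean_space \<Rightarrow> ennreal"
  assumes f: "f \<in> borel_measurable borel"
  shows "(\<integral>\<^sup>+ \<sigma>. f \<sigma> \<partial>sphere_measure)
    = of_nat DIM('a) * (\<integral>\<^sup>+ x. f (sgn x) * indicator (ball 0 1 - {0}) x \<partial>lborel)"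
proof -
  have fm: "f \<in> borel_measurable (restrict_space borel (sphere 0 1))"
    using f by (rule measurable_restrict_space1)
  have "(\<integral>\<^sup>+ \<sigma>. f \<sigma> \<partial>sphere_measure) = of_nat DIM('a) *
     (\<integral>\<^sup>+ \<sigma>. f \<sigma> \<partial>distr (restrict_space lborel (ball 0 1 - {0})) (restrict_space borel (sphere 0 1)) sgn)"
    unfolding sphere_measure_def by (rule nn_integral_scale_measure) (use fm in simp)
  also have "\<dots> = of_nat DIM('a) * (\<integral>\<^sup>+ x. f (sgn x) \<partial>restrict_space lborel (ball 0 1 - {0}))"
    by (subst nn_integral_distr[OF measurable_sgn_sphere]) (use fm in auto)
  also have "\<dots> = of_nat DIM('a) * (\<integral>\<^sup>+ x. f (sgn x) * indicator (ball 0 1 - {0}) x \<partial>lborel)"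
    by (subst nn_integral_restrict_space) auto
  finally show ?thesis .
qed

text \<open>
  Written through the cone over the sphere, the surface measure becomes Lebesgue measure on the ball,
  and Tonelli's theorem applies to two Lebesgue integrals.
\<close>
lemma nn_integral_sphere_swap:
  fixes F :: "'b::euclidean_space \<Rightarrow> 'a::euclidean_space \<Rightarrow> ennreal"
  assumes F[measurable]: "case_prod F \<in> borel_measurable (borel \<Otimes>\<^sub>M borel)"
  shows "(\<integral>\<^sup>+ w. \<integral>\<^sup>+ \<sigma>. F w \<sigma> \<partial>sphere_measure \<partial>lborel)
    = of_nat DIM('a) * (\<integral>\<^sup>+ x. (\<integral>\<^sup>+ w. F w (sgn x) \<partial>lborel) * indicator (ball 0 1 - {0}) x \<partial>lborel)"
proof -
  have 1: "(\<integral>\<^sup>+ \<sigma>. F w \<sigma> \<partial>sphere_measure) =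
      of_nat DIM('a) * (\<integral>\<^sup>+ x. F w (sgn x) * indicator (ball 0 1 - {0}) x \<partial>lborel)" for w
    by (rule nn_integral_sphere_measure) measurable
  have m1: "(\<lambda>w. \<integral>\<^sup>+ x. F w (sgn x) * indicator (ball 0 1 - {0}) x \<partial>lborel) \<in> borel_measurable lborel"
    by measurable
  have m2: "(\<lambda>(w, x). F w (sgn x) * indicator (ball 0 1 - {0}) x) \<in> borel_measurable (lborel \<Otimes>\<^sub>M lborel)"
    by measurable
  have "(\<integral>\<^sup>+ w. \<integral>\<^sup>+ x. F w (sgn x) * indicator (ball 0 1 - {0}) x \<partial>lborel \<partial>lborel)
      = (\<integral>\<^sup>+ x. \<integral>\<^sup>+ w. F w (sgn x) * indicator (ball 0 1 - {0}) x \<partial>lborel \<partial>lborel)"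
    by (rule lborel_pair.Fubini'[OF m2, symmetric])
  also have "\<dots> = (\<integral>\<^sup>+ x. (\<integral>\<^sup>+ w. F w (sgn x) \<partial>lborel) * indicator (ball 0 1 - {0}) x \<partial>lborel)"
    by (intro nn_integral_cong nn_integral_multc) measurable
  finally show ?thesis
    unfolding 1 by (simp add: nn_integral_cmult[OF m1])
qed

text \<open>
  The map \<open>v - rel_velocity \<sigma> p\<close> depends on \<open>\<sigma>\<close>, so the substitution is made in the inner integral after
  exchanging the order of integration, which is then restored.
\<close>
lemma carleman_le:
  fixes F :: "real^3 \<Rightarrow> real^3 \<Rightarrow> real"
  assumes F[measurable]: "case_prod F \<in> borel_measurable (borel \<Otimes>\<^sub>M borel)" and F0: "\<And>w \<sigma>. 0 \<le> F w \<sigma>"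
  shows "(\<integral>\<^sup>+ w. \<integral>\<^sup>+ \<sigma>. ennreal (F w \<sigma>) \<partial>sphere_measure \<partial>lborel) \<le>
    (\<integral>\<^sup>+ p. \<integral>\<^sup>+ \<sigma>. ennreal (if p \<bullet> \<sigma> > 0
       then 4 * (norm p)\<^sup>2 / (p \<bullet> \<sigma>)\<^sup>2 * F (v - rel_velocity \<sigma> p) \<sigma> else 0) \<partial>sphere_measure \<partial>lborel)"
proof -
  let ?G = "\<lambda>p \<sigma>. ennreal (if p \<bullet> \<sigma> > 0
       then 4 * (norm p)\<^sup>2 / (p \<bullet> \<sigma>)\<^sup>2 * F (v - rel_velocity \<sigma> p) \<sigma> else 0)"
  have mF: "(\<lambda>(w, \<sigma>). ennreal (F w \<sigma>)) \<in> borel_measurable (borel \<Otimes>\<^sub>M borel)" by measurable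
  have mG: "(\<lambda>(p, \<sigma>). ?G p \<sigma>) \<in> borel_measurable (borel \<Otimes>\<^sub>M borel)"
    unfolding rel_velocity_def by measurable
  have *: "(\<integral>\<^sup>+ w. ennreal (F w (sgn x)) \<partial>lborel) * indicator (ball 0 1 - {0}) x
     \<le> (\<integral>\<^sup>+ p. ?G p (sgn x) \<partial>lborel) * indicator (ball 0 1 - {0}) x" for x
  proof (cases "x = 0")
    case False
    then have "norm (sgn x) = 1" by (simp add: norm_sgn)
    then have "(\<integral>\<^sup>+ w. ennreal (F w (sgn x)) \<partial>lborel) \<le> (\<integral>\<^sup>+ p. ?G p (sgn x) \<partial>lborel)"
      using F0 by (intro nn_integral_rel_velocity_le) measurable
    then show ?thesis by (rule mult_right_mono) simp
  qed simp
  show ?thesis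
    unfolding nn_integral_sphere_swap[OF mF] nn_integral_sphere_swap[OF mG]
    by (intro mult_left_mono nn_integral_mono *) simp
qed

section \<open>Singular powers and Gaussians on space\<close>

text \<open>
  Finiteness of radial integrals without polar coordinates: a function that is dominated by a series of
  indicators of balls has integral at most the series of the volumes. This serves both for the
  singularity of \<open>|p|\<^sup>b\<close> at the origin and for the decay of the Gaussian at infinity.
\<close>
lemma nn_integral_ball_sum_finite:
  fixes h :: "real^3 \<Rightarrow> ennreal" and a r :: "nat \<Rightarrow> real"
  assumes h: "\<And>p. h p \<le> (\<Sum>n. ennreal (a n) * indicator (ball 0 (r n)) p)"
    and a: "\<And>n. 0 \<le> a n" and r: "\<And>n. 0 \<le> r n" and s: "summable (\<lambda>n. a n * r n ^ 3)"
  shows "(\<integral>\<^sup>+ p. h p \<partial>lborel) < \<infinity>"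
proof -
  have "(\<integral>\<^sup>+ p. h p \<partial>lborel) \<le> (\<integral>\<^sup>+ p. (\<Sum>n. ennreal (a n) * indicator (ball 0 (r n)) p) \<partial>(lborel :: (real^3) measure))"
    by (intro nn_integral_mono h)
  also have "\<dots> = (\<Sum>n. \<integral>\<^sup>+ p. ennreal (a n) * indicator (ball 0 (r n)) p \<partial>(lborel :: (real^3) measure))"
    by (rule nn_integral_suminf) (intro borel_measurable_times_ennreal borel_measurable_const borel_measurable_indicator, simp)
  also have "\<dots> = (\<Sum>n. ennreal (a n * (unit_ball_vol 3 * r n ^ 3)))"
    using a r by (intro suminf_cong) (simp add: nn_integral_cmult_indicator emeasure_ball ennreal_mult)
  also have "\<dots> < \<infinity>"
  proof -
    have "summable (\<lambda>n. a n * (unit_ball_vol 3 * r n ^ 3))"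
      using summable_mult[OF s, of "unit_ball_vol 3"] by (simp add: mult_ac)
    then show ?thesis
      using a r by (subst suminf_ennreal2) auto
  qed
  finally show ?thesis .
qed

text \<open>
  On the dyadic shell \<open>2\<^bsup>-n-1\<^esup> \<le> |p| < 2\<^bsup>-n\<^esup>\<close> the function is at most \<open>2\<^bsup>-(n+1)b\<^esup>\<close>, and the ball has volume
  of order \<open>2\<^bsup>-3n\<^esup>\<close>; the resulting geometric series converges exactly for \<open>b > -3\<close>.
\<close>
lemma nn_integral_powr_ball_finite:
  assumes b: "-3 < b" "b \<le> 0"
  shows "(\<integral>\<^sup>+ p. ennreal (norm (p::real^3) powr b) * indicator (ball 0 1) p \<partial>lborel) < \<infinity>"
proof (rule nn_integral_ball_sum_finite)
  let ?a = "\<lambda>n::nat. (2 powr (- real n - 1)) powr b" and ?r = "\<lambda>n::nat. 2 powr (- real n)"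
  have "?a n * ?r n ^ 3 = 2 powr (-b) * (2 powr (-3 - b)) ^ n" for n
  proof -
    have "?a n * ?r n ^ 3 = 2 powr ((- real n - 1) * b + (- real n) * real 3)"
      by (simp only: powr_powr powr_add powr_power) (simp add: mult.commute)
    also have "(- real n - 1) * b + (- real n) * real 3 = - b + (- 3 - b) * real n"
      by (simp add: algebra_simps)
    also have "2 powr \<dots> = 2 powr (-b) * (2 powr (-3 - b)) ^ n"
      by (simp only: powr_add powr_power) (simp add: mult.commute)
    finally show ?thesis .
  qed
  moreover have "(2::real) powr (-3 - b) < 1"
    using b powr_less_mono[of "-3-b" 0 2] by simp
  ultimately show "summable (\<lambda>n. ?a n * ?r n ^ 3)"
    by (simp add: summable_mult summable_geometric)
  fix p :: "real^3"
  show "ennreal (norm p powr b) * indicator (ball 0 1) p \<le> (\<Sum>n. ennreal (?a n) * indicator (ball 0 (?r n)) p)"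
  proof (cases "p = 0 \<or> norm p \<ge> 1")
    case False
    let ?t = "- log 2 (norm p)"
    have p: "0 < norm p" "norm p < 1" using False by auto
    then have t: "?t > 0" by simp
    define n where "n = nat (\<lceil>?t\<rceil> - 1)"
    have n: "real n < ?t" "?t \<le> real n + 1" using t unfolding n_def by linarith+
    have np: "norm p = 2 powr (- ?t)" using p by simp
    have "norm p < ?r n" by (subst np) (use n in simp)
    moreover have "2 powr (- real n - 1) \<le> norm p" by (subst np) (use n in simp)
    then have "norm p powr b \<le> ?a n" using b by (intro powr_mono2') auto
    ultimately have "ennreal (norm p powr b) * indicator (ball 0 1) p \<le> (\<Sum>i\<in>{n}. ennreal (?a i) * indicator (ball 0 (?r i)) p)"
      by (simp add: ennreal_leI indicator_def)
    also have "\<dots> \<le> (\<Sum>n. ennreal (?a n) * indicator (ball 0 (?r n)) p)"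
      by (intro sum_le_suminf) auto
    finally show ?thesis .
  qed auto
qed auto

text \<open>
  With \<open>M \<ge> N\<close> positive, this is the \<open>M\<close>-th power of \<open>u \<le> exp u\<close> at \<open>u = a (1 + x) / M\<close>.
\<close>
lemma powr_exp_neg_le:
  fixes N a :: real
  assumes "a > 0"
  obtains C where "C > 0" "\<And>x. x \<ge> 0 \<Longrightarrow> (1 + x) powr N * exp (- a * x) \<le> C"
proof -
  define M where "M = max N 1"
  have M: "M > 0" "N \<le> M" unfolding M_def by auto
  let ?C = "(M / a) powr M * exp a"
  have "(1 + x) powr N * exp (- a * x) \<le> ?C" if "x \<ge> 0" for x
  proof -
    have "a * (1 + x) / M \<le> exp (a * (1 + x) / M)" using exp_ge_add_one_self[of "a * (1 + x) / M"] by linarith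
    then have "1 + x \<le> (M / a) * exp (a * (1 + x) / M)" using M assms by (simp add: field_simps)
    then have "(1 + x) powr M \<le> ((M / a) * exp (a * (1 + x) / M)) powr M"
      using that M by (intro powr_mono2) auto
    also have "\<dots> = (M / a) powr M * exp (a * (1 + x))"
      using M assms by (subst powr_mult) (auto simp: exp_powr_real)
    finally have "(1 + x) powr M \<le> (M / a) powr M * exp (a * (1 + x))" .
    moreover have "(1 + x) powr N \<le> (1 + x) powr M" using that M by (intro powr_mono) auto
    ultimately have "(1 + x) powr N * exp (- a * x) \<le> (M / a) powr M * exp (a * (1 + x)) * exp (- a * x)"
      by (intro mult_right_mono) auto
    also have "\<dots> = ?C" by (simp add: algebra_simps flip: exp_add)
    finally show ?thesis .
  qed
  moreover have "?C > 0" using M assms by simp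
  ultimately show thesis using that by blast
qed

lemma japanese_ge_1: "japanese v \<ge> 1" and japanese_pos: "japanese v > 0"
  and japanese_sq: "(japanese v)\<^sup>2 = 1 + (norm v)\<^sup>2" and norm_le_japanese: "norm v \<le> japanese v"
  unfolding japanese_def by (auto intro: real_le_rsqrt add_pos_nonneg)

lemma japanese_powr_gauss_le:
  fixes N a :: real
  assumes "a > 0"
  obtains C where "C > 0" "\<And>x::'a::real_normed_vector. japanese x powr N * exp (- a * (norm x)\<^sup>2) \<le> C"
proof -
  obtain C where C: "C > 0" "\<And>x. x \<ge> 0 \<Longrightarrow> (1 + x) powr (N/2) * exp (- a * x) \<le> C"
    using powr_exp_neg_le[OF assms] by blast
  have "japanese x powr N * exp (- a * (norm x)\<^sup>2) \<le> C" for x :: 'a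
  proof -
    have "japanese x powr N = (1 + (norm x)\<^sup>2) powr (N/2)"
      unfolding japanese_def by (subst powr_half_sqrt[symmetric]) (auto simp: powr_powr)
    then show ?thesis using C(2)[of "(norm x)\<^sup>2"] by simp
  qed
  with C that show thesis by blast
qed

lemma nn_integral_gauss_finite:
  assumes a: "a > 0"
  shows "(\<integral>\<^sup>+ p. ennreal (exp (- a * (norm (p::real^3))\<^sup>2)) \<partial>lborel) < \<infinity>"
proof -
  obtain C where C: "C > 0" "\<And>p::real^3. japanese p powr 5 * exp (- a * (norm p)\<^sup>2) \<le> C"
    using japanese_powr_gauss_le[OF a] by blast
  show ?thesis
  proof (rule nn_integral_ball_sum_finite)
    \<comment> \<open>Decay of order five beats the cubic growth of the volume of the ball of radius \<open>n + 1\<close>.\<close>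
    let ?a = "\<lambda>n::nat. 32 * C / (1 + real n) ^ 5" and ?r = "\<lambda>n::nat. 1 + real n"
    have "(\<lambda>n. ?a n * ?r n ^ 3) = (\<lambda>n. 32 * C * (1 / (real (Suc n))\<^sup>2))"
    proof
      fix n
      have "(1 + real n) ^ 5 = (1 + real n)\<^sup>2 * (1 + real n) ^ 3"
        by (simp flip: power_add)
      moreover have "32 * C / (A * B) * B = 32 * C * (1 / A)" if "B \<noteq> 0" for A B :: real
        using that by simp
      ultimately show "?a n * ?r n ^ 3 = 32 * C * (1 / (real (Suc n))\<^sup>2)"
        by (metis of_nat_Suc add_pos_nonneg of_nat_0_le_iff power_eq_0_iff less_irrefl zero_less_one)
    qed
    moreover have "summable (\<lambda>n. 32 * C * (1 / (real (Suc n))\<^sup>2))"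
      using inverse_squares_sums by (intro summable_mult) (auto simp: summable_def add.commute)
    ultimately show "summable (\<lambda>n. ?a n * ?r n ^ 3)" by simp
    fix p :: "real^3"
    define n where "n = nat \<lfloor>norm p\<rfloor>"
    have "real n = of_int \<lfloor>norm p\<rfloor>" unfolding n_def by simp
    then have n: "real n \<le> norm p" "norm p < 1 + real n" by linarith+
    have "(1 + real n) / 2 \<le> japanese p"
      using add_mono[OF japanese_ge_1[of p] order.trans[OF n(1) norm_le_japanese[of p]]] by simp
    then have "((1 + real n) / 2) ^ 5 \<le> japanese p ^ 5" by (intro power_mono) auto
    then have "((1 + real n) / 2) ^ 5 * exp (- a * (norm p)\<^sup>2) \<le> japanese p powr 5 * exp (- a * (norm p)\<^sup>2)"
      using japanese_pos[of p] by (intro mult_right_mono) (auto simp: powr_numeral)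
    also have "\<dots> \<le> C" by (rule C)
    finally have "exp (- a * (norm p)\<^sup>2) \<le> ?a n" by (simp add: field_simps)
    then have "ennreal (exp (- a * (norm p)\<^sup>2)) \<le> (\<Sum>i\<in>{n}. ennreal (?a i) * indicator (ball 0 (?r i)) p)"
      using n by (simp add: ennreal_leI)
    also have "\<dots> \<le> (\<Sum>n. ennreal (?a n) * indicator (ball 0 (?r n)) p)"
      by (intro sum_le_suminf) auto
    finally show "ennreal (exp (- a * (norm p)\<^sup>2)) \<le> (\<Sum>n. ennreal (?a n) * indicator (ball 0 (?r n)) p)" .
  qed (use C in auto)
qed

section \<open>Japanese brackets and the moments of a shifted Gaussian\<close>

text \<open>
  Peetre's inequality: it is what lets \<open>\<langle>p\<rangle>\<^sup>b\<close>, for either sign of \<open>b\<close>, be exchanged for \<open>\<langle>v\<rangle>\<^sup>b\<close> at the cost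
  of a power of \<open>\<langle>v - p\<rangle>\<close>.
\<close>
lemma japanese_peetre:
  fixes x y :: "'a::real_normed_vector"
  shows "japanese (x + y) \<le> sqrt 2 * japanese x * japanese y"
proof -
  have "norm (x + y) \<le> norm x + norm y" by (rule norm_triangle_ineq)
  then have "(norm (x + y))\<^sup>2 \<le> (norm x + norm y)\<^sup>2" by (intro power_mono) auto
  also have "\<dots> \<le> 2 * (norm x)\<^sup>2 + 2 * (norm y)\<^sup>2"
    using sum_squares_bound[of "norm x" "norm y"] by (simp add: power2_sum)
  finally have "(norm (x + y))\<^sup>2 \<le> 2 * (norm x)\<^sup>2 + 2 * (norm y)\<^sup>2" .
  note le = this
  have "1 + (norm (x + y))\<^sup>2 \<le> 2 * ((1 + (norm x)\<^sup>2) * (1 + (norm y)\<^sup>2))"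
  proof -
    have "2 * ((1 + (norm x)\<^sup>2) * (1 + (norm y)\<^sup>2))
        = 2 + 2 * (norm x)\<^sup>2 + 2 * (norm y)\<^sup>2 + 2 * ((norm x)\<^sup>2 * (norm y)\<^sup>2)"
      by (simp add: algebra_simps)
    moreover have "0 \<le> (norm x)\<^sup>2 * (norm y)\<^sup>2" by simp
    ultimately show ?thesis using le by linarith
  qed
  then have "sqrt (1 + (norm (x + y))\<^sup>2) \<le> sqrt (2 * ((1 + (norm x)\<^sup>2) * (1 + (norm y)\<^sup>2)))"
    by (rule real_sqrt_le_mono)
  then show ?thesis unfolding japanese_def by (simp add: real_sqrt_mult mult.assoc)
qed

lemma japanese_minus: "japanese (- x) = japanese x"
  by (simp add: japanese_def)

lemma japanese_powr_peetre:
  fixes v p :: "'a::real_normed_vector"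
  shows "japanese p powr b \<le> (sqrt 2) powr \<bar>b\<bar> * japanese v powr b * japanese (v - p) powr \<bar>b\<bar>"
proof (cases "b \<ge> 0")
  case True
  have "japanese p \<le> sqrt 2 * japanese v * japanese (v - p)"
    using japanese_peetre[of v "- (v - p)"] japanese_minus[of "v - p"] by simp
  then have "japanese p powr b \<le> (sqrt 2 * japanese v * japanese (v - p)) powr b"
    using True japanese_pos[of p] by (intro powr_mono2) auto
  also have "\<dots> = sqrt 2 powr \<bar>b\<bar> * japanese v powr b * japanese (v - p) powr \<bar>b\<bar>"
    using True japanese_pos[of v] japanese_pos[of "v-p"] by (simp add: powr_mult)
  finally show ?thesis .
next
  case False
  have "japanese v \<le> sqrt 2 * japanese p * japanese (v - p)"
    using japanese_peetre[of p "v - p"] by simp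
  then have "japanese v powr (-b) \<le> (sqrt 2 * japanese p * japanese (v - p)) powr (-b)"
    using False japanese_pos[of v] by (intro powr_mono2) auto
  also have "\<dots> = sqrt 2 powr \<bar>b\<bar> * japanese p powr (-b) * japanese (v - p) powr \<bar>b\<bar>"
    using False japanese_pos[of p] japanese_pos[of "v-p"] by (simp add: powr_mult)
  finally show ?thesis using japanese_pos[of p] japanese_pos[of v]
    by (simp add: powr_minus field_simps)
qed

text \<open>
  Away from the unit ball \<open>|p|\<close> and \<open>\<langle>p\<rangle>\<close> are comparable; inside it \<open>\<langle>p\<rangle>\<close> is of order one, and only a
  negative power of \<open>|p|\<close> has to be kept.
\<close>
lemma norm_powr_le_japanese:
  fixes p :: "'a::real_normed_vector"
  shows "norm p powr b \<le> (sqrt 2) powr \<bar>b\<bar> * japanese p powr b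
     * (1 + norm p powr (min b 0) * indicator (ball 0 1) p)"
proof (cases "b \<ge> 0")
  case True
  have "norm p powr b \<le> japanese p powr b" using True norm_le_japanese[of p] by (intro powr_mono2) auto
  moreover have "1 * 1 * 1 \<le> (sqrt 2) powr \<bar>b\<bar> * 1 * (1 + norm p powr (min b 0) * indicator (ball 0 1) p)"
    using True by (intro mult_mono) (auto intro!: ge_one_powr_ge_zero)
  then have "japanese p powr b * 1 \<le> japanese p powr b * ((sqrt 2) powr \<bar>b\<bar> * (1 + norm p powr (min b 0) * indicator (ball 0 1) p))"
    by (intro mult_left_mono) auto
  ultimately show ?thesis by (simp add: mult_ac)
next
  case False
  show ?thesis
  proof (cases "norm p < 1")
    case True
    have "(japanese p)\<^sup>2 \<le> (sqrt 2)\<^sup>2" using True power_le_one[of "norm p" 2] by (simp add: japanese_sq)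
    then have "japanese p \<le> sqrt 2" by (rule power2_le_imp_le) simp
    then have "sqrt 2 powr b \<le> japanese p powr b" using False japanese_pos[of p] by (intro powr_mono2') auto
    then have "1 \<le> (sqrt 2) powr \<bar>b\<bar> * japanese p powr b"
      using False by (simp add: powr_minus field_simps)
    then have "1 * (norm p powr b) \<le> (sqrt 2) powr \<bar>b\<bar> * japanese p powr b * (1 + norm p powr b)"
      by (intro mult_mono) auto
    then show ?thesis using True False by simp
  next
    case c: False
    show ?thesis
    proof (cases "norm p = 0")
      case False
      have "(japanese p)\<^sup>2 \<le> (sqrt 2 * norm p)\<^sup>2"
        using c power_mono[of 1 "norm p" 2] by (simp add: japanese_sq power_mult_distrib)
      then have "japanese p \<le> sqrt 2 * norm p" by (rule power2_le_imp_le) simp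
      then have "(sqrt 2 * norm p) powr b \<le> japanese p powr b"
        using \<open>\<not> b \<ge> 0\<close> japanese_pos[of p] by (intro powr_mono2') auto
      then have "norm p powr b \<le> (sqrt 2) powr \<bar>b\<bar> * japanese p powr b"
        using \<open>\<not> b \<ge> 0\<close> by (simp add: powr_minus powr_mult field_simps)
      then show ?thesis using c by simp
    qed (use c in simp)
  qed
qed

lemma nn_integral_lborel_shift:
  fixes h :: "'a::euclidean_space \<Rightarrow> ennreal"
  assumes [measurable]: "h \<in> borel_measurable borel"
  shows "(\<integral>\<^sup>+ p. h (p - v) \<partial>lborel) = (\<integral>\<^sup>+ p. h p \<partial>lborel)"
proof -
  have "(\<integral>\<^sup>+ p. h p \<partial>lborel) = (\<integral>\<^sup>+ p. h p \<partial>distr lborel borel ((+) (- v)))"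
    by (simp add: lborel_distr_plus)
  also have "\<dots> = (\<integral>\<^sup>+ p. h (p - v) \<partial>lborel)"
    by (subst nn_integral_distr) auto
  finally show ?thesis ..
qed

text \<open>
  Half of the Gaussian absorbs the power of \<open>\<langle>v - p\<rangle>\<close> from Peetre's inequality. What remains is \<open>\<langle>v\<rangle>\<^sup>b\<close>
  times a local singularity and a Gaussian, both with integrals that do not depend on \<open>v\<close>.
\<close>
lemma nn_integral_powr_gauss_le:
  fixes b :: real
  assumes b: "-3 < b"
  obtains C where "C > 0"
    "\<And>v::real^3. (\<integral>\<^sup>+ p. ennreal (norm p powr b * exp (- (1/4) * (norm (v - p))\<^sup>2)) \<partial>lborel) \<le> ennreal (C * japanese v powr b)"
proof -
  obtain C1 where C1: "C1 > 0" "\<And>x::real^3. japanese x powr \<bar>b\<bar> * exp (- (1/8) * (norm x)\<^sup>2) \<le> C1"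
    using japanese_powr_gauss_le[of "1/8" "\<bar>b\<bar>"] by auto
  define I1 where "I1 = (\<integral>\<^sup>+ p. ennreal (norm (p::real^3) powr (min b 0)) * indicator (ball 0 1) p \<partial>lborel)"
  define I2 where "I2 = (\<integral>\<^sup>+ p. ennreal (exp (- (1/8) * (norm (p::real^3))\<^sup>2)) \<partial>lborel)"
  have fin: "I1 + I2 < \<infinity>"
    unfolding I1_def I2_def using nn_integral_powr_ball_finite[of "min b 0"] nn_integral_gauss_finite[of "1/8"] b by simp
  define C0 where "C0 = sqrt 2 powr \<bar>b\<bar> * sqrt 2 powr \<bar>b\<bar> * C1"
  have C0: "C0 > 0" using C1 by (simp add: C0_def)
  have *: "norm p powr b * exp (- (1/4) * (norm (v - p))\<^sup>2)
     \<le> C0 * japanese v powr b * (norm p powr (min b 0) * indicator (ball 0 1) p + exp (- (1/8) * (norm (p - v))\<^sup>2))" for v p :: "real^3"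
  proof -
    let ?X = "norm p powr (min b 0) * indicator (ball 0 1) p" and ?e = "exp (- (1/8) * (norm (p - v))\<^sup>2)"
    let ?s = "sqrt 2 powr \<bar>b\<bar>"
    have e: "exp (- (1/4) * (norm (v - p))\<^sup>2) = ?e * ?e"
      by (simp add: norm_minus_commute flip: exp_add)
    have "norm p powr b \<le> ?s * (?s * japanese v powr b * japanese (v - p) powr \<bar>b\<bar>) * (1 + ?X)"
      by (rule order.trans[OF norm_powr_le_japanese])
         (intro mult_right_mono mult_left_mono japanese_powr_peetre; simp add: indicator_def)
    then have "norm p powr b * (?e * ?e) \<le> (?s * (?s * japanese v powr b * japanese (v - p) powr \<bar>b\<bar>) * (1 + ?X)) * (?e * ?e)"
      by (intro mult_right_mono) auto
    also have "\<dots> = ?s * ?s * japanese v powr b * (japanese (v - p) powr \<bar>b\<bar> * ?e) * (?e + ?X * ?e)"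
      by (simp add: algebra_simps)
    also have "\<dots> \<le> ?s * ?s * japanese v powr b * C1 * (?e + ?X * 1)"
      using C1(2)[of "v - p"] C1(1)
      by (intro mult_mono add_left_mono mult_left_mono) (auto simp: indicator_def norm_minus_commute)
    finally show ?thesis unfolding e C0_def by (simp add: algebra_simps)
  qed
  have "(\<integral>\<^sup>+ p. ennreal (norm p powr b * exp (- (1/4) * (norm (v - p))\<^sup>2)) \<partial>lborel)
     \<le> ennreal (C0 * enn2real (I1 + I2) * japanese v powr b)" for v :: "real^3"
  proof -
    have "(\<integral>\<^sup>+ p. ennreal (norm p powr b * exp (- (1/4) * (norm (v - p))\<^sup>2)) \<partial>lborel)
      \<le> (\<integral>\<^sup>+ p. ennreal (C0 * japanese v powr b) * (ennreal (norm p powr (min b 0)) * indicator (ball 0 1) p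
          + ennreal (exp (- (1/8) * (norm (p - v))\<^sup>2))) \<partial>lborel)"
    proof (rule nn_integral_mono)
      fix p :: "real^3"
      have "ennreal (norm p powr b * exp (- (1/4) * (norm (v - p))\<^sup>2)) \<le>
         ennreal (C0 * japanese v powr b * (norm p powr (min b 0) * indicator (ball 0 1) p + exp (- (1/8) * (norm (p - v))\<^sup>2)))"
        by (intro ennreal_leI *)
      also have "\<dots> = ennreal (C0 * japanese v powr b) * (ennreal (norm p powr (min b 0)) * indicator (ball 0 1) p
          + ennreal (exp (- (1/8) * (norm (p - v))\<^sup>2)))"
        using C0 by (subst ennreal_mult) (auto simp: ennreal_plus indicator_def)
      finally show "ennreal (norm p powr b * exp (- (1/4) * (norm (v - p))\<^sup>2)) \<le> \<dots>" .
    qed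
    also have "\<dots> = ennreal (C0 * japanese v powr b) * (I1 + (\<integral>\<^sup>+ p. ennreal (exp (- (1/8) * (norm (p - v))\<^sup>2)) \<partial>lborel))"
    proof -
      have m1: "(\<lambda>p::real^3. ennreal (norm p powr min b 0) * indicator (ball 0 1) p) \<in> borel_measurable lborel"
        by (intro borel_measurable_times_ennreal borel_measurable_indicator) auto
      have m2: "(\<lambda>p::real^3. ennreal (exp (- (1/8) * (norm (p - v))\<^sup>2))) \<in> borel_measurable lborel"
        by measurable
      show ?thesis
        unfolding I1_def nn_integral_add[OF m1 m2, symmetric]
        by (intro nn_integral_cmult borel_measurable_add m1 m2)
    qed
    also have "(\<integral>\<^sup>+ p. ennreal (exp (- (1/8) * (norm (p - v))\<^sup>2)) \<partial>lborel) = I2"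
      unfolding I2_def by (rule nn_integral_lborel_shift) measurable
    also have "ennreal (C0 * japanese v powr b) * (I1 + I2) = ennreal (C0 * enn2real (I1 + I2) * japanese v powr b)"
    proof -
      have "I1 + I2 = ennreal (enn2real (I1 + I2))" using fin by simp
      then show ?thesis using C0 by (metis ennreal_mult enn2real_nonneg less_imp_le mult.assoc mult.commute mult_nonneg_nonneg powr_ge_zero)
    qed
    finally show ?thesis .
  qed
  note le = this
  show thesis
  proof (rule that)
    show "C0 * enn2real (I1 + I2) + 1 > 0" using C0 by (simp add: add_nonneg_pos)
    fix v :: "real^3"
    have "ennreal (C0 * enn2real (I1 + I2) * japanese v powr b) \<le> ennreal ((C0 * enn2real (I1 + I2) + 1) * japanese v powr b)"
      by (intro ennreal_leI mult_right_mono) auto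
    then show "(\<integral>\<^sup>+ p. ennreal (norm p powr b * exp (- (1/4) * (norm (v - p))\<^sup>2)) \<partial>lborel)
        \<le> ennreal ((C0 * enn2real (I1 + I2) + 1) * japanese v powr b)"
      by (rule order.trans[OF le])
  qed
qed

section \<open>Powers of the cosine on the unit sphere\<close>

text \<open>
  On the cone over the sphere let \<open>x\<^sub>\<bottom>\<close> be the part of \<open>x\<close> orthogonal to \<open>e\<close>. In the unit ball
  \<open>cos\<^sup>2 = 1 - |x\<^sub>\<bottom>|\<^sup>2 / |x|\<^sup>2 \<le> 1 - |x\<^sub>\<bottom>|\<^sup>2 \<le> exp (- |x\<^sub>\<bottom>|\<^sup>2)\<close>, so \<open>cos\<^sup>m\<close> is at most a constant times an
  anisotropic Gaussian with variance \<open>1 / (m + 1)\<close> in the two directions orthogonal to \<open>e\<close>. A linear map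
  of determinant \<open>1 / (m + 1)\<close> makes it isotropic, so no rotation to a coordinate axis is needed.
\<close>
lemma nn_integral_sphere_cos_powr_le:
  obtains A where "A > 0" "\<And>m (e :: real^3). m \<ge> 0 \<Longrightarrow> norm e = 1 \<Longrightarrow>
    (\<integral>\<^sup>+ \<sigma>. ennreal (if e \<bullet> \<sigma> > 0 then (e \<bullet> \<sigma>) powr m else 0) \<partial>sphere_measure) \<le> ennreal (A / (m + 1))"
proof -
  define I where "I = (\<integral>\<^sup>+ p. ennreal (exp (- (1/2) * (norm (p::real^3))\<^sup>2)) \<partial>lborel)"
  have fin: "I < \<infinity>" unfolding I_def by (rule nn_integral_gauss_finite) simp
  define A where "A = 3 * exp 1 * enn2real I + 1"
  have "(\<integral>\<^sup>+ \<sigma>. ennreal (if e \<bullet> \<sigma> > 0 then (e \<bullet> \<sigma>) powr m else 0) \<partial>sphere_measure) \<le> ennreal (A / (m + 1))"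
    if m: "m \<ge> 0" and e: "norm e = 1" for m and e :: "real^3"
  proof -
    \<comment> \<open>The map \<open>?g\<close> fixes \<open>e\<close> and contracts its orthogonal complement by the factor \<open>s\<close>.\<close>
    define s where "s = 1 / sqrt (m + 1)"
    have s: "s > 0" "s^2 = 1 / (m + 1)" using m by (auto simp: s_def power_divide)
    have ee: "e \<bullet> e = 1" using e by (simp add: dot_square_norm)
    let ?g = "\<lambda>h. s *\<^sub>R h + (((1 - s) *\<^sub>R e) \<bullet> h) *\<^sub>R e"
    let ?F = "\<lambda>x::real^3. exp (- (1/2) * ((m + 1) * ((norm x)\<^sup>2 - (e \<bullet> x)\<^sup>2) + (e \<bullet> x)\<^sup>2))"
    have Q: "(m + 1) * ((norm (?g x))\<^sup>2 - (e \<bullet> ?g x)\<^sup>2) + (e \<bullet> ?g x)\<^sup>2 = (norm x)\<^sup>2" for x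
    proof -
      have 1: "e \<bullet> ?g x = e \<bullet> x" by (simp add: inner_add_right ee algebra_simps)
      have "(norm (?g x))\<^sup>2 = s^2 * (x \<bullet> x) + 2 * s * (1 - s) * (e \<bullet> x)^2 + (1 - s)^2 * (e \<bullet> x)^2"
        unfolding power2_norm_eq_inner
        by (simp add: inner_add_left inner_add_right ee inner_commute[of x e] power2_eq_square algebra_simps)
      then have "(norm (?g x))\<^sup>2 - (e \<bullet> ?g x)\<^sup>2 = s^2 * (x \<bullet> x - (e \<bullet> x)^2)"
        unfolding 1 by (simp add: power2_eq_square algebra_simps)
      then show ?thesis unfolding 1 s(2) using m by (simp add: dot_square_norm)
    qed
    have det: "\<bar>det (matrix ?g)\<bar> = 1 / (m + 1)"
      unfolding det_id_plus_rank_one[where s = s and a = e and b = "(1 - s) *\<^sub>R e"]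
      using s m by (simp add: ee)
    have lin: "linear ?g"
      by (rule linearI) (auto simp: inner_add_right algebra_simps)
    have inv: "?g ((1/s) *\<^sub>R y + (((1 - 1/s) *\<^sub>R e) \<bullet> y) *\<^sub>R e) = y" for y
      using s by (simp add: inner_add_right ee algebra_simps divide_simps flip: scaleR_add_left scaleR_diff_left)
    have surj: "range ?g = UNIV" using inv by (metis (no_types, lifting) surj_def)
    have "inj ?g" using linear_surjective_imp_injective[OF lin] surj by blast
    have step: "(\<integral>\<^sup>+ x. ennreal (?F x) \<partial>lborel) \<le> (\<integral>\<^sup>+ x. ennreal (1 / (m + 1) * exp (- (1/2) * (norm (x::real^3))\<^sup>2)) \<partial>lborel)"
    proof (rule nn_integral_change_of_variables_le[where S = UNIV and g = ?g and g' = "\<lambda>_. ?g"])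
      show "(?g has_derivative ?g) (at x within UNIV)" for x
        using lin linear_imp_has_derivative by blast
      show "inj_on ?g UNIV" by fact
      show "negligible (- range ?g)" using surj by simp
      show "\<bar>det (matrix ?g)\<bar> * ?F (?g x) = 1 / (m + 1) * exp (- (1/2) * (norm x)\<^sup>2)" for x
        unfolding Q det ..
    qed (use m in auto)
    have "(\<integral>\<^sup>+ \<sigma>. ennreal (if e \<bullet> \<sigma> > 0 then (e \<bullet> \<sigma>) powr m else 0) \<partial>sphere_measure)
      = 3 * (\<integral>\<^sup>+ x. ennreal (if e \<bullet> sgn x > 0 then (e \<bullet> sgn x) powr m else 0) * indicator (ball 0 1 - {0}) x \<partial>lborel)"
      by (subst nn_integral_sphere_measure) auto
    also have "\<dots> \<le> 3 * (\<integral>\<^sup>+ x. ennreal (exp 1) * ennreal (?F x) \<partial>lborel)"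
    proof (intro mult_left_mono nn_integral_mono)
      fix x :: "real^3"
      show "ennreal (if e \<bullet> sgn x > 0 then (e \<bullet> sgn x) powr m else 0) * indicator (ball 0 1 - {0}) x
        \<le> ennreal (exp 1) * ennreal (?F x)"
      proof (cases "x \<in> ball 0 1 - {0} \<and> e \<bullet> sgn x > 0")
        case True
        then have x: "0 < norm x" "norm x < 1" and pos: "e \<bullet> sgn x > 0" by auto
        let ?c = "e \<bullet> sgn x"
        have ex: "e \<bullet> x = norm x * ?c" using x by (simp add: sgn_div_norm)
        have c1: "?c \<le> 1" using norm_cauchy_schwarz[of e "sgn x"] e x by (simp add: norm_sgn)
        have d: "0 \<le> 1 - ?c^2" using c1 pos by (simp add: power_le_one)
        have n1: "(norm x)\<^sup>2 \<le> 1" using x by (simp add: power_le_one)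
        \<comment> \<open>The summands \<open>1\<close> of \<open>m + 1\<close> and \<open>(e \<bullet> x)\<^sup>2\<close> in the exponent cost a factor of at most \<open>exp 1\<close> in the ball.\<close>
        have "?c^2 \<le> exp (- (1 - ?c^2))" using exp_ge_add_one_self[of "- (1 - ?c^2)"] by simp
        then have le: "(?c^2) powr (m/2) \<le> (exp (- (1 - ?c^2))) powr (m/2)"
          using m by (intro powr_mono2) auto
        have "?c powr m \<le> exp (- (1/2) * (m * (1 - ?c^2)))"
        proof -
          have "(?c^2) powr (m/2) = ?c powr m" using pos by (simp add: powr_powr flip: powr_numeral)
          moreover have "(exp (- (1 - ?c^2))) powr (m/2) = exp (- (1/2) * (m * (1 - ?c^2)))"
            unfolding exp_powr_real by (simp add: algebra_simps)
          ultimately show ?thesis using le by simp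
        qed
        also have "\<dots> \<le> exp (1 + - (1/2) * ((m + 1) * ((norm x)\<^sup>2 - (e \<bullet> x)\<^sup>2) + (e \<bullet> x)\<^sup>2))"
        proof -
          have eq: "(norm x)\<^sup>2 - (e \<bullet> x)\<^sup>2 = (norm x)\<^sup>2 * (1 - ?c^2)" by (simp add: ex power_mult_distrib algebra_simps)
          have a: "(norm x)\<^sup>2 * (1 - ?c^2) \<le> 1 * (1 - ?c^2)" using n1 d by (intro mult_right_mono) auto
          then have "m * ((norm x)\<^sup>2 * (1 - ?c^2)) \<le> m * (1 - ?c^2)" using m by (intro mult_left_mono) auto
          moreover have "(norm x)\<^sup>2 * (1 - ?c^2) \<le> 1" using a by (smt (verit) zero_le_power2)
          moreover have "(e \<bullet> x)\<^sup>2 \<le> 1"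
          proof -
            have "(e \<bullet> x)\<^sup>2 = (norm x)\<^sup>2 * ?c\<^sup>2" by (simp add: ex power_mult_distrib)
            also have "\<dots> \<le> 1 * 1" using n1 d by (intro mult_mono) auto
            finally show ?thesis by simp
          qed
          moreover have "- (1/2) * X \<le> 1 + - (1/2) * (Y + 1 * Z + E)"
            if "Y \<le> X" "Z \<le> 1" "E \<le> 1" for X Y Z E :: real
            using that by (simp add: field_simps)
          ultimately show ?thesis unfolding eq exp_le_cancel_iff distrib_right by blast
        qed
        also have "\<dots> = exp 1 * ?F x" by (rule exp_add)
        finally show ?thesis using True by (simp add: ennreal_leI flip: ennreal_mult)
      qed auto
    qed auto
    also have "\<dots> = 3 * (ennreal (exp 1) * (\<integral>\<^sup>+ x. ennreal (?F x) \<partial>lborel))"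
      by (subst nn_integral_cmult) auto
    also have "\<dots> \<le> 3 * (ennreal (exp 1) * (\<integral>\<^sup>+ x. ennreal (1 / (m + 1) * exp (- (1/2) * (norm (x::real^3))\<^sup>2)) \<partial>lborel))"
      by (intro mult_left_mono step) auto
    also have "\<dots> = 3 * (ennreal (exp 1) * (ennreal (1 / (m + 1)) * I))"
    proof -
      have "(\<integral>\<^sup>+ x. ennreal (1 / (m + 1) * exp (- (1/2) * (norm (x::real^3))\<^sup>2)) \<partial>lborel)
        = (\<integral>\<^sup>+ x. ennreal (1 / (m + 1)) * ennreal (exp (- (1/2) * (norm (x::real^3))\<^sup>2)) \<partial>lborel)"
        using m by (intro nn_integral_cong ennreal_mult) auto
      also have "\<dots> = ennreal (1 / (m + 1)) * I"
        unfolding I_def by (rule nn_integral_cmult) measurable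
      finally show ?thesis by simp
    qed
    also have "\<dots> = ennreal (3 * (exp 1 * (1 / (m + 1) * enn2real I)))"
    proof -
      obtain i where i: "I = ennreal i" "i \<ge> 0" using fin by (cases I) auto
      have 3: "3 = ennreal 3" by simp
      show ?thesis using m i(2) unfolding i(1) by (subst 3) (simp flip: ennreal_mult del: ennreal_numeral)
    qed
    also have "\<dots> \<le> ennreal (A / (m + 1))"
      using m by (intro ennreal_leI) (simp add: A_def field_simps)
    finally show ?thesis .
  qed
  moreover have "A > 0" by (simp add: A_def add_nonneg_pos)
  ultimately show thesis using that by blast
qed

section \<open>The collision integral in the new variables\<close>

definition collision_integrand :: "real \<Rightarrow> real \<Rightarrow> real^3 \<Rightarrow> real^3 \<Rightarrow> real^3 \<Rightarrow> real" where
  "collision_integrand \<gamma> k v w \<sigma> = norm (v - w) powr \<gamma> * (japanese v powr k / japanese (post v w \<sigma>) powr k)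
     * exp (- (1/2) * (norm (post_star v w \<sigma>))\<^sup>2)"

lemma collision_integrand_nonneg: "0 \<le> collision_integrand \<gamma> k v w \<sigma>"
  by (simp add: collision_integrand_def)

lemma collision_integrand_measurable [measurable]:
  "(\<lambda>(w, \<sigma>). collision_integrand \<gamma> k v w \<sigma>) \<in> borel_measurable (borel \<Otimes>\<^sub>M borel)"
  unfolding collision_integrand_def japanese_def post_def post_star_def by measurable

lemma ennreal_mult_add:
  "0 \<le> a \<Longrightarrow> 0 \<le> b \<Longrightarrow> 0 \<le> c \<Longrightarrow> 0 \<le> d \<Longrightarrow>
    ennreal a * ennreal b + ennreal c * ennreal d = ennreal (a * b + c * d)"
  by (simp add: ennreal_mult ennreal_plus)

text \<open>
  This reduces every estimate to a pointwise bound after the change of variables. A term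
  \<open>|p|\<^sup>\<gamma> c\<^sup>m\<close> contributes the factor \<open>1 / (m + 1)\<close> from the sphere, and the terms with \<open>a2\<close> and \<open>a3\<close> are
  bounded on the sphere. The denominator \<open>c\<^sup>2\<close> on the left is the Jacobian up to the factor four,
  and \<open>K\<close> depends on the two exponents only.
\<close>
lemma collision_integral_le:
  fixes \<gamma> \<beta> :: real
  assumes g: "-3 < \<gamma>" and b: "-3 < \<beta>"
  obtains K where "K > 0"
    "\<And>(F :: real^3 \<Rightarrow> real^3 \<Rightarrow> real) v a1 a2 a3 m.
      \<lbrakk>case_prod F \<in> borel_measurable (borel \<Otimes>\<^sub>M borel); \<And>w \<sigma>. 0 \<le> F w \<sigma>;
       0 \<le> a1; 0 \<le> a2; 0 \<le> a3; 0 \<le> m;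
       \<And>p \<sigma>. \<lbrakk>norm \<sigma> = 1; 0 < sgn p \<bullet> \<sigma>; sgn p \<bullet> \<sigma> \<le> 1; p \<noteq> 0\<rbrakk> \<Longrightarrow>
         F (v - rel_velocity \<sigma> p) \<sigma> / (sgn p \<bullet> \<sigma>)\<^sup>2 \<le>
         (a1 * norm p powr \<gamma> * (sgn p \<bullet> \<sigma>) powr m + a2 * norm p powr \<beta> + a3 * norm p powr \<gamma>)
           * exp (- (1/4) * (norm (v - p))\<^sup>2)\<rbrakk> \<Longrightarrow>
      (\<integral>\<^sup>+ w. \<integral>\<^sup>+ \<sigma>. ennreal (F w \<sigma>) \<partial>sphere_measure \<partial>lborel)
        \<le> ennreal (K * ((a1 / (m + 1) + a3) * japanese v powr \<gamma> + a2 * japanese v powr \<beta>))"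
proof -
  obtain A where A: "A > 0" "\<And>m (e :: real^3). m \<ge> 0 \<Longrightarrow> norm e = 1 \<Longrightarrow>
    (\<integral>\<^sup>+ \<sigma>. ennreal (if e \<bullet> \<sigma> > 0 then (e \<bullet> \<sigma>) powr m else 0) \<partial>sphere_measure) \<le> ennreal (A / (m + 1))"
    using nn_integral_sphere_cos_powr_le by blast
  obtain Cg where Cg: "Cg > 0" "\<And>v::real^3. (\<integral>\<^sup>+ p. ennreal (norm p powr \<gamma> * exp (- (1/4) * (norm (v - p))\<^sup>2)) \<partial>lborel) \<le> ennreal (Cg * japanese v powr \<gamma>)"
    using nn_integral_powr_gauss_le[OF g] by blast
  obtain Cb where Cb: "Cb > 0" "\<And>v::real^3. (\<integral>\<^sup>+ p. ennreal (norm p powr \<beta> * exp (- (1/4) * (norm (v - p))\<^sup>2)) \<partial>lborel) \<le> ennreal (Cb * japanese v powr \<beta>)"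
    using nn_integral_powr_gauss_le[OF b] by blast
  show thesis
  proof (rule that[of "4 * A * (Cg + Cb)"])
    show "4 * A * (Cg + Cb) > 0" using A Cg Cb by simp
  next
    fix F :: "real^3 \<Rightarrow> real^3 \<Rightarrow> real" and v a1 a2 a3 m
    assume F[measurable]: "case_prod F \<in> borel_measurable (borel \<Otimes>\<^sub>M borel)" and F0: "\<And>w \<sigma>. 0 \<le> F w \<sigma>"
      and a: "0 \<le> a1" "0 \<le> a2" "0 \<le> a3" "0 \<le> m"
      and B: "\<And>p \<sigma>. \<lbrakk>norm \<sigma> = 1; 0 < sgn p \<bullet> \<sigma>; sgn p \<bullet> \<sigma> \<le> 1; p \<noteq> 0\<rbrakk> \<Longrightarrow>
         F (v - rel_velocity \<sigma> p) \<sigma> / (sgn p \<bullet> \<sigma>)\<^sup>2 \<le>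
         (a1 * norm p powr \<gamma> * (sgn p \<bullet> \<sigma>) powr m + a2 * norm p powr \<beta> + a3 * norm p powr \<gamma>)
           * exp (- (1/4) * (norm (v - p))\<^sup>2)"
    let ?g = "\<lambda>p. norm p powr \<gamma> * exp (- (1/4) * (norm (v - p))\<^sup>2)"
    let ?b = "\<lambda>p. norm p powr \<beta> * exp (- (1/4) * (norm (v - p))\<^sup>2)"
    let ?T = "\<lambda>m p \<sigma>. if sgn p \<bullet> \<sigma> > 0 then (sgn p \<bullet> \<sigma>) powr m else (0::real)"
    let ?L = "japanese v"
    have inner: "(\<integral>\<^sup>+ \<sigma>. ennreal (if p \<bullet> \<sigma> > 0
       then 4 * (norm p)\<^sup>2 / (p \<bullet> \<sigma>)\<^sup>2 * F (v - rel_velocity \<sigma> p) \<sigma> else 0) \<partial>sphere_measure)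
       \<le> ennreal (4 * A * (a1 / (m + 1) + a3)) * ennreal (?g p) + ennreal (4 * A * a2) * ennreal (?b p)" (is "?lhs \<le> ?rhs") for p
    proof (cases "p = 0")
      case False
      have pm: "(\<lambda>\<sigma>. ?T m p \<sigma>) \<in> borel_measurable sphere_measure" for m
        unfolding measurable_cong_sets[OF sets_sphere_measure refl]
        by (rule measurable_restrict_space1) measurable
      have "?lhs \<le> (\<integral>\<^sup>+ \<sigma>. ennreal (4 * a1 * ?g p) * ennreal (?T m p \<sigma>)
          + ennreal (4 * (a2 * ?b p + a3 * ?g p)) * ennreal (?T 0 p \<sigma>) \<partial>sphere_measure)"
      proof (rule nn_integral_mono)
        fix \<sigma> :: "real^3" assume "\<sigma> \<in> space sphere_measure"
        then have s: "norm \<sigma> = 1" by simp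
        let ?c = "sgn p \<bullet> \<sigma>"
        have pc: "p \<bullet> \<sigma> = norm p * ?c" using False by (simp add: sgn_div_norm)
        have c1: "?c \<le> 1" using norm_cauchy_schwarz[of "sgn p" \<sigma>] s False by (simp add: norm_sgn)
        show "ennreal (if p \<bullet> \<sigma> > 0 then 4 * (norm p)\<^sup>2 / (p \<bullet> \<sigma>)\<^sup>2 * F (v - rel_velocity \<sigma> p) \<sigma> else 0)
          \<le> ennreal (4 * a1 * ?g p) * ennreal (?T m p \<sigma>)
            + ennreal (4 * (a2 * ?b p + a3 * ?g p)) * ennreal (?T 0 p \<sigma>)"
        proof (cases "?c > 0")
          case True
          then have pos: "p \<bullet> \<sigma> > 0" using False by (simp add: pc)
          have "4 * (norm p)\<^sup>2 / (p \<bullet> \<sigma>)\<^sup>2 * F (v - rel_velocity \<sigma> p) \<sigma> = 4 * (F (v - rel_velocity \<sigma> p) \<sigma> / ?c\<^sup>2)"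
            using False by (simp add: pc power_mult_distrib)
          also have "\<dots> \<le> 4 * ((a1 * norm p powr \<gamma> * ?c powr m + a2 * norm p powr \<beta> + a3 * norm p powr \<gamma>)
              * exp (- (1/4) * (norm (v - p))\<^sup>2))"
            using B[OF s True c1 False] by simp
          also have "\<dots> = (4 * a1 * ?g p) * ?T m p \<sigma> + (4 * (a2 * ?b p + a3 * ?g p)) * ?T 0 p \<sigma>"
            using True by (simp add: algebra_simps)
          finally show ?thesis using pos a
            by (simp add: ennreal_leI flip: ennreal_mult ennreal_plus)
        next
          case c: False
          then have "\<not> p \<bullet> \<sigma> > 0" using False by (simp add: pc zero_less_mult_iff)
          then show ?thesis by simp
        qed
      qed
      also have "\<dots> = ennreal (4 * a1 * ?g p) * (\<integral>\<^sup>+ \<sigma>. ennreal (?T m p \<sigma>) \<partial>sphere_measure)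
          + ennreal (4 * (a2 * ?b p + a3 * ?g p)) * (\<integral>\<^sup>+ \<sigma>. ennreal (?T 0 p \<sigma>) \<partial>sphere_measure)"
        using pm[of m] pm[of 0] by (subst nn_integral_add) (auto simp: nn_integral_cmult)
      also have "\<dots> \<le> ennreal (4 * a1 * ?g p) * ennreal (A / (m + 1)) + ennreal (4 * (a2 * ?b p + a3 * ?g p)) * ennreal A"
        using False a A(2)[of 0 "sgn p"] by (intro add_mono mult_left_mono A(2)[of m "sgn p"]) (auto simp: norm_sgn)
      also have "\<dots> = ennreal (4 * a1 * ?g p * (A / (m + 1)) + 4 * (a2 * ?b p + a3 * ?g p) * A)"
        using a A(1) by (intro ennreal_mult_add) auto
      also have "4 * a1 * ?g p * (A / (m + 1)) + 4 * (a2 * ?b p + a3 * ?g p) * A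
         = 4 * A * (a1 / (m + 1) + a3) * ?g p + 4 * A * a2 * ?b p"
        by (simp add: algebra_simps add_divide_distrib)
      also have "ennreal \<dots> = ?rhs"
        using a A(1) by (intro ennreal_mult_add[symmetric]) auto
      finally show ?thesis .
    qed simp
    have "(\<integral>\<^sup>+ w. \<integral>\<^sup>+ \<sigma>. ennreal (F w \<sigma>) \<partial>sphere_measure \<partial>lborel) \<le>
       (\<integral>\<^sup>+ p. ennreal (4 * A * (a1 / (m + 1) + a3)) * ennreal (?g p) + ennreal (4 * A * a2) * ennreal (?b p) \<partial>lborel)"
      by (rule order.trans[OF carleman_le[OF F F0] nn_integral_mono[OF inner]])
    also have "\<dots> = ennreal (4 * A * (a1 / (m + 1) + a3)) * (\<integral>\<^sup>+ p. ennreal (?g p) \<partial>lborel)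
        + ennreal (4 * A * a2) * (\<integral>\<^sup>+ p. ennreal (?b p) \<partial>lborel)"
      by (subst nn_integral_add) (auto simp: nn_integral_cmult)
    also have "\<dots> \<le> ennreal (4 * A * (a1 / (m + 1) + a3)) * ennreal (Cg * ?L powr \<gamma>)
        + ennreal (4 * A * a2) * ennreal (Cb * ?L powr \<beta>)"
      by (intro add_mono mult_left_mono Cg(2) Cb(2)) auto
    also have "\<dots> = ennreal (4 * A * (a1 / (m + 1) + a3) * (Cg * ?L powr \<gamma>) + 4 * A * a2 * (Cb * ?L powr \<beta>))"
      using a A(1) Cg(1) Cb(1) by (intro ennreal_mult_add) auto
    also have "\<dots> \<le> ennreal (4 * A * (a1 / (m + 1) + a3) * ((Cg + Cb) * ?L powr \<gamma>) + 4 * A * a2 * ((Cg + Cb) * ?L powr \<beta>))"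
      using a A(1) Cg(1) Cb(1) by (intro ennreal_leI add_mono mult_left_mono mult_right_mono) auto
    also have "\<dots> = ennreal (4 * A * (Cg + Cb) * ((a1 / (m + 1) + a3) * ?L powr \<gamma> + a2 * ?L powr \<beta>))"
      by (simp add: algebra_simps)
    finally show "(\<integral>\<^sup>+ w. \<integral>\<^sup>+ \<sigma>. ennreal (F w \<sigma>) \<partial>sphere_measure \<partial>lborel)
      \<le> ennreal (4 * A * (Cg + Cb) * ((a1 / (m + 1) + a3) * ?L powr \<gamma> + a2 * ?L powr \<beta>))" .
  qed
qed

text \<open>
  The deflection \<open>v' - v = |p| / c \<sigma> - p\<close> is orthogonal to \<open>p\<close>. Hence its inner product with \<open>v\<close> equals the one
  with \<open>v - p\<close>, which the Gaussian keeps small; this is the source of the lower bound for \<open>\<langle>v'\<rangle>\<close>.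
\<close>
lemma collision_geometry:
  fixes v p \<sigma> :: "real^3"
  defines "w \<equiv> v - rel_velocity \<sigma> p" and "c \<equiv> sgn p \<bullet> \<sigma>"
  assumes s: "norm \<sigma> = 1" and c: "c > 0" and p: "p \<noteq> 0"
  defines "y \<equiv> norm (v - post v w \<sigma>)"
  shows "norm (v - w) = norm p / c"
    and "post_star v w \<sigma> = v - p"
    and "y\<^sup>2 = (norm p / c)\<^sup>2 - (norm p)\<^sup>2"
    and "(japanese (post v w \<sigma>))\<^sup>2 \<ge> (japanese v)\<^sup>2 - 2 * norm (v - p) * y + y\<^sup>2"
proof -
  have pc: "p \<bullet> \<sigma> = norm p * c" using p by (simp add: c_def sgn_div_norm)
  have pos: "p \<bullet> \<sigma> > 0" using p c by (simp add: pc)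
  have q: "norm (rel_velocity \<sigma> p) = norm p / c"
    using norm_rel_velocity[OF s pos] p by (simp add: pc power2_eq_square)
  then show vw: "norm (v - w) = norm p / c" by (simp add: w_def)
  have half: "(1/2) *\<^sub>R rel_velocity \<sigma> p = p - (norm p / c / 2) *\<^sub>R \<sigma>"
    using p by (simp add: rel_velocity_def pc power2_eq_square scaleR_diff_right)
  have vw2: "(1/2) *\<^sub>R (v + w) = v - (1/2) *\<^sub>R rel_velocity \<sigma> p"
    by (simp add: w_def scaleR_diff_right scaleR_add_right flip: scaleR_add_left)
  show "post_star v w \<sigma> = v - p"
    unfolding post_star_def vw vw2 half by simp
  define Y where "Y = (norm p / c) *\<^sub>R \<sigma> - p"
  have *: "v - (p - a) + a = v + ((a + a) - p)" for a :: "real^3"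
    by (simp add: algebra_simps)
  have **: "(norm p / c / 2) *\<^sub>R \<sigma> + (norm p / c / 2) *\<^sub>R \<sigma> = (norm p / c) *\<^sub>R \<sigma>"
    by (metis field_sum_of_halves scaleR_add_left)
  have po: "post v w \<sigma> = v + Y"
    unfolding post_def vw vw2 half Y_def * ** ..
  have orth: "p \<bullet> Y = 0"
    using c by (simp add: Y_def inner_diff_right pc dot_square_norm power2_eq_square)
  have y: "y = norm Y" unfolding y_def po by simp
  have "Y \<bullet> Y = (norm p / c)\<^sup>2 - (norm p)\<^sup>2"
  proof -
    have "Y \<bullet> Y = (norm p / c) * (\<sigma> \<bullet> Y)" using orth unfolding Y_def by (simp add: inner_diff_left)
    also have "\<sigma> \<bullet> Y = norm p / c - norm p * c"
      using s by (simp add: Y_def inner_diff_right inner_commute[of \<sigma> p] pc dot_square_norm)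
    finally show ?thesis using c by (simp add: power2_eq_square algebra_simps)
  qed
  then show "y\<^sup>2 = (norm p / c)\<^sup>2 - (norm p)\<^sup>2" unfolding y power2_norm_eq_inner by simp
  have vY: "v \<bullet> Y = (v - p) \<bullet> Y" using orth by (simp add: inner_diff_left)
  have CS: "\<bar>(v - p) \<bullet> Y\<bar> \<le> norm (v - p) * norm Y" by (rule Cauchy_Schwarz_ineq2)
  have "(norm (v + Y))\<^sup>2 = (norm v)\<^sup>2 + 2 * (v \<bullet> Y) + (norm Y)\<^sup>2"
    unfolding power2_norm_eq_inner by (simp add: inner_add_left inner_add_right inner_commute[of Y v])
  then show "(japanese (post v w \<sigma>))\<^sup>2 \<ge> (japanese v)\<^sup>2 - 2 * norm (v - p) * y + y\<^sup>2"
    unfolding japanese_sq po y vY using CS by linarith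
qed

section \<open>Bounds for the weight\<close>

lemma le_mult_ge_1: "0 \<le> (a::real) \<Longrightarrow> 1 \<le> x \<Longrightarrow> a \<le> a * x"
  by (metis mult.right_neutral mult_left_mono)

text \<open>
  Here \<open>P = |p|\<close>, \<open>L = \<langle>v\<rangle>\<close>, \<open>Z = \<langle>v - p\<rangle>\<close>, \<open>z = |v - p|\<close>, \<open>y = |v' - v|\<close> and \<open>J = \<langle>v'\<rangle>\<close>. The hypothesis on \<open>L\<close>
  gives \<open>8 k z\<^sup>2 \<le> L\<^sup>2\<close> and \<open>P \<ge> L / 2\<close>, hence \<open>J\<^sup>2 \<ge> L\<^sup>2 (1 - 1 / (4 k)) (1 + t)\<close> with \<open>8 t = tan\<^sup>2 \<alpha>\<close>. The
  power \<open>k / 2\<close> of the first bracket is bounded below uniformly in \<open>k\<close>. For the second one,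
  \<open>1 + t \<ge> c\<^bsup>-2\<^esup> / 8\<close> is raised to the fixed power \<open>3 / 2\<close>, which keeps the full power \<open>c\<^sup>3\<close>, while
  Bernoulli's inequality \<open>(1 + t)\<^sup>8 \<ge> c\<^bsup>-2\<^esup>\<close>, which loses no constant, is used for the remaining
  power \<open>(k - 3) / 2\<close>.
\<close>
lemma weight_ratio_le_cos_powr:
  fixes c k P L z y J :: real
  assumes k: "k > 3" and c: "0 < c" "c \<le> 1" and L: "L > (2 + sqrt (8 * k)) * Z" and Z: "Z \<ge> 1" "0 \<le> z" "z \<le> Z"
    and P: "0 < P" "sqrt (L\<^sup>2 - 1) \<le> P + z"
    and y: "0 \<le> y" "y\<^sup>2 = (P / c)\<^sup>2 - P\<^sup>2" and J: "0 < J" "J\<^sup>2 \<ge> L\<^sup>2 - 2 * z * y + y\<^sup>2"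
  shows "L powr k / J powr k \<le> 8 powr (3/2) * exp 1 * c powr (3 + (k - 3) / 8)"
proof -
  define t where "t = (1 / c\<^sup>2 - 1) / 8"
  have t0: "t \<ge> 0" using c by (simp add: t_def power_le_one)
  have sk: "sqrt (8 * k) \<ge> 0" using k by simp
  have "2 + sqrt (8 * k) \<le> (2 + sqrt (8 * k)) * Z" using sk Z(1) by (intro le_mult_ge_1) auto
  then have "2 + sqrt (8 * k) < L" using L by (rule le_less_trans)
  then have L2: "L > 2" using sk by linarith
  have "(2 + sqrt (8 * k)) * Z \<ge> sqrt (8 * k) * z" using Z sk by (intro mult_mono) auto
  then have "sqrt (8 * k) * z \<le> L" using L by linarith
  then have "(sqrt (8 * k) * z)\<^sup>2 \<le> L\<^sup>2" using Z sk by (intro power_mono) auto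
  then have zk: "8 * k * z\<^sup>2 \<le> L\<^sup>2" using k by (simp add: power_mult_distrib)
  have z24: "24 * z\<^sup>2 \<le> L\<^sup>2"
  proof -
    have "24 * z\<^sup>2 \<le> 8 * k * z\<^sup>2" using k by (intro mult_right_mono) auto
    then show ?thesis using zk by linarith
  qed
  have LL: "L\<^sup>2 \<ge> 4" using power_mono[of 2 L 2] L2 by simp
  have PL: "P \<ge> L / 2"
  proof (rule ccontr)
    assume "\<not> P \<ge> L / 2"
    have "81 * z\<^sup>2 \<le> 4 * L\<^sup>2" using z24 zero_le_power2[of z] by linarith
    then have "(9/2 * z)\<^sup>2 \<le> L\<^sup>2" by (simp add: power_mult_distrib power_divide)
    then have zL: "9/2 * z \<le> L" using L2 by (intro power2_le_imp_le[of "9/2 * z" L]) auto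
    \<comment> \<open>\<open>|v| \<ge> 5 L / 6\<close> and \<open>z \<le> 2 L / 9\<close> leave more than \<open>L / 2\<close> for \<open>|p|\<close>.\<close>
    have "(L * 5/6)\<^sup>2 \<le> L\<^sup>2 - 1" using LL by (simp add: power_mult_distrib power_divide)
    then have "L * 5/6 \<le> sqrt (L\<^sup>2 - 1)" by (rule real_le_rsqrt)
    then have "L * 5 / 6 \<le> P + z" using P by linarith
    then show False using \<open>\<not> P \<ge> L / 2\<close> zL L2 by linarith
  qed
  define r where "r = 1 - 1 / (4 * k)"
  have r: "r > 0" using k by (simp add: r_def)
  have Jr: "J\<^sup>2 \<ge> L\<^sup>2 * r * (1 + t)"
  proof -
    \<comment> \<open>Completing the square spends half of \<open>y\<^sup>2\<close> on the cross term.\<close>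
    have "0 \<le> (2 * z - y)\<^sup>2" by simp
    then have "2 * z * y \<le> 2 * z\<^sup>2 + y\<^sup>2 / 2" by (simp add: power2_diff field_simps power2_eq_square)
    moreover have "2 * z\<^sup>2 \<le> L\<^sup>2 * (1 / (4 * k))" using zk k by (simp add: field_simps)
    ultimately have "J\<^sup>2 \<ge> L\<^sup>2 * r + y\<^sup>2 / 2" using J unfolding r_def right_diff_distrib by linarith
    moreover have "y\<^sup>2 / 2 \<ge> L\<^sup>2 * t"
    proof -
      have "y\<^sup>2 / 2 = P\<^sup>2 * (4 * t)" using c y by (simp add: t_def power_divide field_simps)
      moreover have "P\<^sup>2 \<ge> (L / 2)\<^sup>2" using PL L2 by (intro power_mono) auto
      then have "P\<^sup>2 * (4 * t) \<ge> (L/2)\<^sup>2 * (4 * t)" using t0 by (intro mult_right_mono) auto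
      ultimately show ?thesis by (simp add: power_divide mult_ac)
    qed
    moreover have "L\<^sup>2 * t \<ge> L\<^sup>2 * t * r" using t0 k by (simp add: r_def mult_left_le)
    ultimately show ?thesis by (simp add: algebra_simps)
  qed
  have b1: "(1 + t) powr ((k - 3) / 2) \<ge> c powr (- ((k - 3) / 8))"
  proof -
    have "1 / c\<^sup>2 = 1 + real 8 * t" using c by (simp add: t_def field_simps)
    also have "\<dots> \<le> (1 + t) ^ 8" using t0 by (intro Bernoulli_inequality) simp
    finally have "(1 / c\<^sup>2) powr ((k - 3) / 16) \<le> ((1 + t) ^ 8) powr ((k - 3) / 16)"
      using k by (intro powr_mono2) auto
    also have "((1 + t) ^ 8) powr ((k - 3) / 16) = (1 + t) powr ((k - 3) / 2)"
    proof -
      have "(1 + t) ^ 8 = (1 + t) powr 8" using t0 by (simp flip: powr_numeral)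
      moreover have "8 * ((k - 3) / 16) = (k - 3) / 2" by (simp add: field_simps)
      ultimately show ?thesis by (simp only: powr_powr)
    qed
    also have "(1 / c\<^sup>2) powr ((k - 3) / 16) = c powr (- ((k - 3) / 8))"
    proof -
      have "1 / c\<^sup>2 = c powr (-2)" using c by (simp add: powr_minus_divide)
      moreover have "-2 * ((k - 3) / 16) = - ((k - 3) / 8)" by (simp add: field_simps)
      ultimately show ?thesis by (simp only: powr_powr)
    qed
    finally show ?thesis .
  qed
  have b2: "(1 + t) powr (3/2) \<ge> c powr (-3) / 8 powr (3/2)"
  proof -
    have "1 / c\<^sup>2 / 8 \<le> 1 + t" by (simp add: t_def diff_divide_distrib)
    then have "(1 / c\<^sup>2 / 8) powr (3/2) \<le> (1 + t) powr (3/2)" using c by (intro powr_mono2) auto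
    moreover have "(1 / c\<^sup>2 / 8) powr (3/2) = (1 / c\<^sup>2) powr (3/2) / 8 powr (3/2)"
      by (rule powr_divide)
    moreover have "(1 / c\<^sup>2) powr (3/2) = c powr (-3)"
      using c by (simp add: powr_divide powr_powr powr_minus_divide flip: powr_numeral)
    ultimately show ?thesis by simp
  qed
  have b3: "r powr (k / 2) \<ge> exp (-1)"
  proof -
    have "1 / r = 1 + 1 / (4 * k - 1)" using k by (simp add: r_def field_simps)
    also have "\<dots> \<le> exp (1 / (4 * k - 1))" by (rule exp_ge_add_one_self)
    finally have "(1 / r) powr (k/2) \<le> exp (1 / (4 * k - 1)) powr (k / 2)" using r k by (intro powr_mono2) auto
    also have "\<dots> \<le> exp 1" using k by (simp add: exp_powr_real field_simps)
    finally show ?thesis using r by (simp add: powr_divide exp_minus field_simps)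
  qed
  have "exp (-1) * (c powr (- ((k - 3) / 8)) * (c powr (-3) / 8 powr (3/2)))
     \<le> r powr (k/2) * ((1 + t) powr ((k - 3) / 2) * (1 + t) powr (3/2))"
    by (intro mult_mono b1 b2 b3) auto
  also have "\<dots> = r powr (k/2) * (1 + t) powr (k/2)"
    by (simp add: diff_divide_distrib flip: powr_add)
  also have "\<dots> = (r * (1 + t)) powr (k/2)" using r t0 by (simp add: powr_mult)
  also have "\<dots> \<le> (J\<^sup>2 / L\<^sup>2) powr (k/2)"
    using Jr L2 r t0 k by (intro powr_mono2) (auto simp: field_simps)
  also have "\<dots> = J powr k / L powr k"
    using J L2 by (simp add: powr_divide powr_powr flip: powr_numeral)
  finally have *: "exp (-1) * (c powr (- ((k - 3) / 8)) * (c powr (-3) / 8 powr (3/2))) \<le> J powr k / L powr k" .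
  have "exp (-1) * (c powr (- ((k - 3) / 8)) * (c powr (-3) / 8 powr (3/2)))
    = 1 / (8 powr (3/2) * exp 1 * c powr (3 + (k - 3) / 8))"
  proof -
    have "1 / E * (1 / X * (1 / Y / S)) = 1 / (S * E * (Y * X))" for E X Y S :: real
      by simp
    then show ?thesis unfolding powr_add powr_minus_divide exp_minus inverse_eq_divide .
  qed
  then have "1 / (8 powr (3/2) * exp 1 * c powr (3 + (k - 3) / 8)) \<le> J powr k / L powr k" using * by simp
  then show ?thesis using J L2 c by (simp add: field_simps)
qed

text \<open>
  The second form moves the surplus of \<open>\<gamma>\<close> over \<open>\<beta>\<close> from \<open>|p|\<close> to the relative speed \<open>P / c\<close>; for
  \<open>\<beta> \<le> -2\<close> the power of \<open>c\<close> that is left is bounded.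
\<close>
lemma powr_split_exponents:
  fixes P c :: real
  assumes "P > 0" "c > 0"
  shows "(P / c) powr \<gamma> / c\<^sup>2 = P powr \<gamma> * c powr (- \<gamma> - 2)"
    and "(P / c) powr \<gamma> / c\<^sup>2 = P powr \<beta> * (P / c) powr (\<gamma> - \<beta>) * c powr (- \<beta> - 2)"
  using assms by (simp_all add: powr_divide powr_diff powr_minus field_simps flip: powr_numeral)

text \<open>
  The relative speed satisfies \<open>P / c \<le> P + y\<close>, and both summands are at most \<open>\<surd>2 L Z J\<close>; the power
  \<open>J\<^bsup>\<gamma>-\<beta>\<^esup>\<close> is absorbed by \<open>J\<^bsup>-k\<^esup>\<close>. Powers of \<open>L\<close> and \<open>Z\<close> are wasted generously, because in the region where
  this bound is used the Gaussian dominates them.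
\<close>
lemma transformed_kernel_le_crude:
  fixes c k P L Z y J \<gamma> \<beta> :: real
  assumes k: "\<gamma> - \<beta> \<le> k" and b: "\<beta> \<le> -2" "\<beta> < \<gamma>" and c: "0 < c" "c \<le> 1" and P: "0 < P" "P \<le> sqrt 2 * L * Z"
    and y: "0 \<le> y" "y\<^sup>2 = (P / c)\<^sup>2 - P\<^sup>2" "y \<le> sqrt 2 * L * J"
    and J: "1 \<le> J" and L: "1 \<le> L" and Z: "1 \<le> Z"
  shows "(P / c) powr \<gamma> / c\<^sup>2 * (L powr k / J powr k)
    \<le> P powr \<beta> * (2 * sqrt 2) powr (\<gamma> - \<beta>) * Z powr (\<gamma> - \<beta>) * L powr (k + \<gamma> - \<beta>)"
proof -
  have "(P / c)\<^sup>2 \<le> (P + y)\<^sup>2" using y P by (simp add: power2_sum)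
  then have "P / c \<le> P + y" using P y by (intro power2_le_imp_le[of "P/c"]) auto
  also have "P \<le> sqrt 2 * L * Z * J"
    by (rule order.trans[OF P(2) le_mult_ge_1]) (use L Z J in auto)
  also have "y \<le> sqrt 2 * L * J * Z"
    by (rule order.trans[OF y(3) le_mult_ge_1]) (use L Z J in auto)
  also have "sqrt 2 * L * J * Z = sqrt 2 * L * Z * J" by simp
  finally have "P / c \<le> 2 * sqrt 2 * L * Z * J" by (simp add: mult_ac)
  then have "(P / c) powr (\<gamma> - \<beta>) \<le> (2 * sqrt 2 * L * Z * J) powr (\<gamma> - \<beta>)"
    using b P c by (intro powr_mono2) auto
  also have "\<dots> = (2 * sqrt 2) powr (\<gamma> - \<beta>) * L powr (\<gamma> - \<beta>) * Z powr (\<gamma> - \<beta>) * J powr (\<gamma> - \<beta>)"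
    using L Z J by (simp add: powr_mult)
  finally have 1: "(P / c) powr (\<gamma> - \<beta>) \<le> \<dots>" .
  have "c powr (- \<beta> - 2) \<le> c powr 0" using c b by (intro powr_mono') auto
  then have 2: "c powr (- \<beta> - 2) \<le> 1" using c by simp
  have 3: "J powr (\<gamma> - \<beta>) \<le> J powr k" using k J by (intro powr_mono) auto
  have "(P / c) powr \<gamma> / c\<^sup>2 * (L powr k / J powr k)
    = P powr \<beta> * (P / c) powr (\<gamma> - \<beta>) * c powr (- \<beta> - 2) * (L powr k / J powr k)"
    using powr_split_exponents(2)[OF P(1) c(1), of \<gamma> \<beta>] by simp
  also have "\<dots> \<le> P powr \<beta> * ((2 * sqrt 2) powr (\<gamma> - \<beta>) * L powr (\<gamma> - \<beta>) * Z powr (\<gamma> - \<beta>) * J powr (\<gamma> - \<beta>)) * 1 * (L powr k / J powr k)"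
    by (intro mult_right_mono mult_mono mult_left_mono 1 2) auto
  also have "\<dots> = P powr \<beta> * (2 * sqrt 2) powr (\<gamma> - \<beta>) * Z powr (\<gamma> - \<beta>) * L powr (k + \<gamma> - \<beta>) * (J powr (\<gamma> - \<beta>) / J powr k)"
    using L by (simp add: powr_add powr_diff field_simps)
  also have "\<dots> \<le> P powr \<beta> * (2 * sqrt 2) powr (\<gamma> - \<beta>) * Z powr (\<gamma> - \<beta>) * L powr (k + \<gamma> - \<beta>) * 1"
    using 3 J by (intro mult_left_mono) auto
  finally show ?thesis by simp
qed

section \<open>Pointwise bounds for the transformed integrand\<close>

lemma norm_eq_sqrt_japanese: "norm v = sqrt ((japanese v)\<^sup>2 - 1)"
  by (simp add: japanese_sq)

lemma norm_diff_le_japanese: "norm (x - y) \<le> sqrt 2 * japanese x * japanese y"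
  using norm_le_japanese[of "x - y"] japanese_peetre[of x "- y"] japanese_minus[of y] by simp

lemma japanese_le_add_norm: "japanese x \<le> japanese y + norm (x - y)"
proof (rule power2_le_imp_le)
  have "norm x \<le> norm y + norm (x - y)" using norm_triangle_ineq[of y "x - y"] by simp
  then have "(norm x)\<^sup>2 \<le> (norm y + norm (x - y))\<^sup>2" by (intro power_mono) auto
  moreover have "2 * norm y * norm (x - y) \<le> 2 * japanese y * norm (x - y)"
    using norm_le_japanese[of y] by (intro mult_right_mono) auto
  ultimately show "(japanese x)\<^sup>2 \<le> (japanese y + norm (x - y))\<^sup>2"
    by (simp add: power2_sum japanese_sq)
  show "0 \<le> japanese y + norm (x - y)" using japanese_pos[of y] by (simp add: add_nonneg_nonneg)
qed

text \<open>
  An exponent in \<open>(-3, -2]\<close> strictly below \<open>\<gamma>\<close>: it is locally integrable as a power of \<open>|p|\<close>, while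
  \<open>c\<^bsup>-\<beta>-2\<^esup>\<close> stays bounded. The difference \<open>\<gamma> - \<beta>\<close> remains below \<open>max 3 (3 + \<gamma>)\<close>, hence below \<open>k\<close>.
\<close>
definition sing_exp :: "real \<Rightarrow> real" where "sing_exp \<gamma> = min (-2) ((\<gamma> - 3) / 2)"

lemma sing_exp_props:
  assumes "-3 < \<gamma>"
  shows "-3 < sing_exp \<gamma>" "sing_exp \<gamma> \<le> -2" "sing_exp \<gamma> < \<gamma>" "\<gamma> - sing_exp \<gamma> < max 3 (3 + \<gamma>)"
  using assms by (auto simp: sing_exp_def min_def max_def field_simps)

lemma collision_integrand_transformed:
  fixes v p \<sigma> :: "real^3"
  assumes "norm \<sigma> = 1" "sgn p \<bullet> \<sigma> > 0" "p \<noteq> 0"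
  shows "collision_integrand \<gamma> k v (v - rel_velocity \<sigma> p) \<sigma> / (sgn p \<bullet> \<sigma>)\<^sup>2
    = (norm p / (sgn p \<bullet> \<sigma>)) powr \<gamma> / (sgn p \<bullet> \<sigma>)\<^sup>2
      * (japanese v powr k / japanese (post v (v - rel_velocity \<sigma> p) \<sigma>) powr k)
      * (exp (- (1/4) * (norm (v - p))\<^sup>2) * exp (- (1/4) * (norm (v - p))\<^sup>2))"
  unfolding collision_integrand_def collision_geometry(1,2)[OF assms] exp_add[symmetric] by simp

text \<open>
  The two summands come from the two regions \<open>\<langle>v\<rangle> > M \<langle>v - p\<rangle>\<close> and \<open>\<langle>v\<rangle> \<le> M \<langle>v - p\<rangle>\<close>. The constant in front
  of the first one is absolute; everything that depends on \<open>k\<close> is put into \<open>C\<close>. Half of the Gaussian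
  is kept for the integration in \<open>p\<close>.
\<close>
lemma collision_integrand_pointwise:
  fixes \<gamma> k :: real
  assumes g: "-3 < \<gamma>" "\<gamma> \<le> 1" and k: "k > max 3 (3 + \<gamma>)"
  obtains C where "C > 0" "\<And>v p \<sigma> :: real^3. \<lbrakk>norm \<sigma> = 1; 0 < sgn p \<bullet> \<sigma>; sgn p \<bullet> \<sigma> \<le> 1; p \<noteq> 0\<rbrakk> \<Longrightarrow>
    collision_integrand \<gamma> k v (v - rel_velocity \<sigma> p) \<sigma> / (sgn p \<bullet> \<sigma>)\<^sup>2 \<le>
      (8 powr (3/2) * exp 1 * norm p powr \<gamma> * (sgn p \<bullet> \<sigma>) powr ((k - 3) / 8)
        + C * japanese v powr (\<gamma> - 2 - sing_exp \<gamma>) * norm p powr (sing_exp \<gamma>))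
      * exp (- (1/4) * (norm (v - p))\<^sup>2)"
proof -
  let ?\<beta> = "sing_exp \<gamma>"
  note b = sing_exp_props[OF g(1)]
  \<comment> \<open>Large enough for lemma \<open>weight_ratio_le_cos_powr\<close>, namely for \<open>L \<ge> 2\<close> and \<open>8 k z\<^sup>2 \<le> L\<^sup>2\<close>.\<close>
  define M where "M = 2 + sqrt (8 * k)"
  have M: "M > 0" using k by (simp add: M_def add_pos_nonneg)
  obtain C1 where C1: "C1 > 0" "\<And>x::real^3. japanese x powr (k + 2 + \<gamma> - ?\<beta>) * exp (- (1/4) * (norm x)\<^sup>2) \<le> C1"
    using japanese_powr_gauss_le[of "1/4" "k + 2 + \<gamma> - ?\<beta>"] by auto
  let ?C = "(2 * sqrt 2) powr (\<gamma> - ?\<beta>) * M powr (k + 2) * C1"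
  show thesis
  proof (rule that[of ?C])
    show "?C > 0" using M C1 by simp
    fix v p \<sigma> :: "real^3"
    assume s: "norm \<sigma> = 1" and c: "0 < sgn p \<bullet> \<sigma>" "sgn p \<bullet> \<sigma> \<le> 1" and p: "p \<noteq> 0"
    let ?w = "v - rel_velocity \<sigma> p" and ?c = "sgn p \<bullet> \<sigma>" and ?P = "norm p" and ?L = "japanese v"
      and ?Z = "japanese (v - p)" and ?z = "norm (v - p)"
    let ?J = "japanese (post v ?w \<sigma>)" and ?y = "norm (v - post v ?w \<sigma>)"
    let ?E = "exp (- (1/4) * ?z\<^sup>2)"
    note geo = collision_geometry[OF s c(1) p, of v]
    have P0: "?P > 0" using p by simp
    have E: "0 < ?E" "?E \<le> 1" by auto
    have A0: "0 \<le> 8 powr (3/2) * exp 1 * ?P powr \<gamma> * ?c powr ((k - 3) / 8)"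
      and B0: "0 \<le> ?C * ?L powr (\<gamma> - 2 - ?\<beta>) * ?P powr ?\<beta>" using C1(1) by auto
    show "collision_integrand \<gamma> k v ?w \<sigma> / ?c\<^sup>2 \<le>
      (8 powr (3/2) * exp 1 * ?P powr \<gamma> * ?c powr ((k - 3) / 8)
        + ?C * ?L powr (\<gamma> - 2 - ?\<beta>) * ?P powr ?\<beta>) * ?E"
    proof (cases "?L > M * ?Z")
      case True
      have "sqrt (?L\<^sup>2 - 1) \<le> ?P + ?z"
        using norm_triangle_ineq[of p "v - p"] unfolding norm_eq_sqrt_japanese[of v, symmetric] by simp
      then have "?L powr k / ?J powr k \<le> 8 powr (3/2) * exp 1 * ?c powr (3 + (k - 3) / 8)"
        using True k geo(3,4) unfolding M_def
        by (intro weight_ratio_le_cos_powr[where Z = ?Z and z = ?z and P = ?P and y = ?y] c P0)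
           (auto simp: japanese_ge_1 japanese_pos norm_le_japanese)
      then have "(?P / ?c) powr \<gamma> / ?c\<^sup>2 * (?L powr k / ?J powr k)
        \<le> ?P powr \<gamma> * ?c powr (- \<gamma> - 2) * (8 powr (3/2) * exp 1 * ?c powr (3 + (k - 3) / 8))"
        unfolding powr_split_exponents(1)[OF P0 c(1)] by (intro mult_left_mono) auto
      also have "\<dots> = 8 powr (3/2) * exp 1 * ?P powr \<gamma> * (?c powr (1 - \<gamma>) * ?c powr ((k - 3) / 8))"
        by (simp add: flip: powr_add) (simp add: algebra_simps)
      also have "\<dots> \<le> 8 powr (3/2) * exp 1 * ?P powr \<gamma> * (1 * ?c powr ((k - 3) / 8))"
        using c g powr_mono'[of 0 "1 - \<gamma>" ?c] by (intro mult_left_mono mult_right_mono) auto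
      finally have "(?P / ?c) powr \<gamma> / ?c\<^sup>2 * (?L powr k / ?J powr k)
        \<le> 8 powr (3/2) * exp 1 * ?P powr \<gamma> * ?c powr ((k - 3) / 8)" by simp
      then have "(?P / ?c) powr \<gamma> / ?c\<^sup>2 * (?L powr k / ?J powr k) * (?E * ?E)
        \<le> (8 powr (3/2) * exp 1 * ?P powr \<gamma> * ?c powr ((k - 3) / 8)) * (1 * ?E)"
        by (rule mult_mono) (use E A0 in auto)
      also have "\<dots> \<le> (8 powr (3/2) * exp 1 * ?P powr \<gamma> * ?c powr ((k - 3) / 8)
        + ?C * ?L powr (\<gamma> - 2 - ?\<beta>) * ?P powr ?\<beta>) * ?E"
        unfolding mult_1_left using B0 E by (intro mult_right_mono) auto
      finally show ?thesis unfolding collision_integrand_transformed[OF s c(1) p] .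
    next
      case False
      have Py: "?P \<le> sqrt 2 * ?L * ?Z" "?y \<le> sqrt 2 * ?L * ?J"
        using norm_diff_le_japanese[of v "v - p"] norm_diff_le_japanese[of v "post v ?w \<sigma>"] by simp_all
      have "(?P / ?c) powr \<gamma> / ?c\<^sup>2 * (?L powr k / ?J powr k)
        \<le> ?P powr ?\<beta> * (2 * sqrt 2) powr (\<gamma> - ?\<beta>) * ?Z powr (\<gamma> - ?\<beta>) * ?L powr (k + \<gamma> - ?\<beta>)"
        by (rule transformed_kernel_le_crude[OF _ b(2,3) c P0 Py(1) _ geo(3) Py(2)]) (use b k in \<open>auto simp: japanese_ge_1\<close>)
      then have "(?P / ?c) powr \<gamma> / ?c\<^sup>2 * (?L powr k / ?J powr k) * (?E * ?E)
        \<le> ?P powr ?\<beta> * (2 * sqrt 2) powr (\<gamma> - ?\<beta>) * ?Z powr (\<gamma> - ?\<beta>) * ?L powr (k + \<gamma> - ?\<beta>) * (?E * ?E)"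
        using E by (intro mult_right_mono) auto
      also have "\<dots> = ?P powr ?\<beta> * (2 * sqrt 2) powr (\<gamma> - ?\<beta>) * ?L powr (\<gamma> - 2 - ?\<beta>) * (?L powr (k + 2) * (?Z powr (\<gamma> - ?\<beta>) * ?E)) * ?E"
      proof -
        have "?L powr (k + \<gamma> - ?\<beta>) = ?L powr (\<gamma> - 2 - ?\<beta>) * ?L powr (k + 2)"
          by (simp add: algebra_simps flip: powr_add)
        then show ?thesis by (simp add: mult_ac)
      qed
      also have "\<dots> \<le> ?P powr ?\<beta> * (2 * sqrt 2) powr (\<gamma> - ?\<beta>) * ?L powr (\<gamma> - 2 - ?\<beta>) * (M powr (k + 2) * C1) * ?E"
      proof -
        have "?L powr (k + 2) \<le> (M * ?Z) powr (k + 2)"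
          using False k japanese_pos[of v] by (intro powr_mono2) auto
        also have "\<dots> = M powr (k + 2) * ?Z powr (k + 2)" using M japanese_pos[of "v - p"] by (simp add: powr_mult)
        finally have "?L powr (k + 2) * (?Z powr (\<gamma> - ?\<beta>) * ?E) \<le> M powr (k + 2) * ?Z powr (k + 2) * (?Z powr (\<gamma> - ?\<beta>) * ?E)"
          by (intro mult_right_mono) auto
        also have "\<dots> = M powr (k + 2) * (?Z powr (k + 2 + \<gamma> - ?\<beta>) * ?E)"
          by (simp add: algebra_simps flip: powr_add)
        also have "\<dots> \<le> M powr (k + 2) * C1" by (intro mult_left_mono C1(2)) auto
        finally show ?thesis by (intro mult_right_mono mult_left_mono) auto
      qed
      also have "\<dots> = ?C * ?L powr (\<gamma> - 2 - ?\<beta>) * ?P powr ?\<beta> * ?E" by (simp add: mult_ac)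
      also have "\<dots> \<le> (8 powr (3/2) * exp 1 * ?P powr \<gamma> * ?c powr ((k - 3) / 8)
        + ?C * ?L powr (\<gamma> - 2 - ?\<beta>) * ?P powr ?\<beta>) * ?E"
        using A0 E by (intro mult_right_mono) auto
      finally show ?thesis unfolding collision_integrand_transformed[OF s c(1) p] .
    qed
  qed
qed

text \<open>
  With \<open>y = |v' - v|\<close> and \<open>L = \<langle>v\<rangle>\<close>, a deflection \<open>y < \<epsilon> L\<close> with \<open>\<epsilon> \<le> 1/2\<close> leaves \<open>\<langle>v'\<rangle> \<ge> L / 2\<close>, so the
  weights are harmless. If \<open>|p| < \<surd>\<epsilon> L\<close>, the relative speed is at most \<open>2 \<surd>\<epsilon> L\<close>, and its positive power
  \<open>\<gamma> - \<beta>\<close> is small. Otherwise \<open>tan\<^sup>2 \<alpha> \<le> \<epsilon>\<close>, so that \<open>c\<close> to the power \<open>1 / \<epsilon>\<close> is bounded below: inserting it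
  costs a constant, and its integral over the sphere is \<open>O(\<epsilon>)\<close>.
\<close>
lemma small_deflection_pointwise:
  fixes \<gamma> k \<epsilon> :: real and v p \<sigma> :: "real^3"
  assumes g: "-3 < \<gamma>" "\<gamma> \<le> 1" and k: "k > 0" and e: "0 < \<epsilon>" "\<epsilon> \<le> 1/2"
    and s: "norm \<sigma> = 1" and c: "0 < sgn p \<bullet> \<sigma>" "sgn p \<bullet> \<sigma> \<le> 1" and p: "p \<noteq> 0"
    and small: "norm (v - post v (v - rel_velocity \<sigma> p) \<sigma>) < \<epsilon> * japanese v"
  shows "collision_integrand \<gamma> k v (v - rel_velocity \<sigma> p) \<sigma> / (sgn p \<bullet> \<sigma>)\<^sup>2 \<le>
      (2 powr k * 4 * exp 1 * norm p powr \<gamma> * (sgn p \<bullet> \<sigma>) powr (1 / \<epsilon>)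
        + 2 powr k * (2 * sqrt \<epsilon>) powr (\<gamma> - sing_exp \<gamma>) * japanese v powr (\<gamma> - sing_exp \<gamma>) * norm p powr (sing_exp \<gamma>))
      * exp (- (1/4) * (norm (v - p))\<^sup>2)"
proof -
  let ?w = "v - rel_velocity \<sigma> p" and ?c = "sgn p \<bullet> \<sigma>" and ?P = "norm p" and ?L = "japanese v" and ?\<beta> = "sing_exp \<gamma>"
  let ?J = "japanese (post v ?w \<sigma>)" and ?y = "norm (v - post v ?w \<sigma>)"
  let ?E = "exp (- (1/4) * (norm (v - p))\<^sup>2)"
  note b = sing_exp_props[OF g(1)]
  note geo = collision_geometry[OF s c(1) p, of v]
  have P0: "?P > 0" using p by simp
  have L0: "?L > 0" by (rule japanese_pos)
  have "?L \<le> ?J + ?y" by (rule japanese_le_add_norm)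
  moreover have "\<epsilon> * ?L \<le> 1/2 * ?L" using e L0 by (intro mult_right_mono) auto
  ultimately have "?L \<le> 2 * ?J" using small by linarith
  then have "?L powr k \<le> (2 * ?J) powr k" using L0 k by (intro powr_mono2) auto
  then have r: "?L powr k / ?J powr k \<le> 2 powr k"
    using japanese_pos[of "post v ?w \<sigma>"] by (simp add: powr_mult field_simps)
  have y2: "?y\<^sup>2 \<le> \<epsilon>\<^sup>2 * ?L\<^sup>2" using small e power_mono[of ?y "\<epsilon> * ?L" 2] by (simp add: power_mult_distrib)
  have core: "(?P / ?c) powr \<gamma> / ?c\<^sup>2 \<le> 4 * exp 1 * ?P powr \<gamma> * ?c powr (1 / \<epsilon>)
      + (2 * sqrt \<epsilon>) powr (\<gamma> - ?\<beta>) * ?L powr (\<gamma> - ?\<beta>) * ?P powr ?\<beta>"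
  proof (cases "?P < sqrt \<epsilon> * ?L")
    case True
    have "?P\<^sup>2 \<le> (sqrt \<epsilon> * ?L)\<^sup>2" using True by (intro power_mono) auto
    then have "?P\<^sup>2 \<le> \<epsilon> * ?L\<^sup>2" using e by (simp add: power_mult_distrib)
    moreover have "\<epsilon>\<^sup>2 * ?L\<^sup>2 \<le> \<epsilon> * ?L\<^sup>2" using e by (intro mult_right_mono) (auto simp: power2_eq_square)
    moreover have "0 \<le> \<epsilon> * ?L\<^sup>2" using e by simp
    ultimately have "(?P / ?c)\<^sup>2 \<le> 4 * (\<epsilon> * ?L\<^sup>2)" using geo(3) y2 by linarith
    also have "4 * (\<epsilon> * ?L\<^sup>2) = (2 * sqrt \<epsilon> * ?L)\<^sup>2" using e by (simp add: power_mult_distrib)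
    finally have "?P / ?c \<le> 2 * sqrt \<epsilon> * ?L" using e L0 by (intro power2_le_imp_le[of "?P / ?c"]) auto
    then have "(?P / ?c) powr (\<gamma> - ?\<beta>) \<le> (2 * sqrt \<epsilon> * ?L) powr (\<gamma> - ?\<beta>)"
      using b P0 c by (intro powr_mono2) auto
    also have "\<dots> = (2 * sqrt \<epsilon>) powr (\<gamma> - ?\<beta>) * ?L powr (\<gamma> - ?\<beta>)"
      using e L0 by (simp add: powr_mult)
    finally have 1: "(?P / ?c) powr (\<gamma> - ?\<beta>) \<le> (2 * sqrt \<epsilon>) powr (\<gamma> - ?\<beta>) * ?L powr (\<gamma> - ?\<beta>)" .
    have 2: "?c powr (- ?\<beta> - 2) \<le> 1" using powr_mono'[of 0 "- ?\<beta> - 2" ?c] c b by simp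
    have "(?P / ?c) powr \<gamma> / ?c\<^sup>2 = ?P powr ?\<beta> * (?P / ?c) powr (\<gamma> - ?\<beta>) * ?c powr (- ?\<beta> - 2)"
      by (rule powr_split_exponents(2)[OF P0 c(1)])
    also have "\<dots> \<le> ?P powr ?\<beta> * ((2 * sqrt \<epsilon>) powr (\<gamma> - ?\<beta>) * ?L powr (\<gamma> - ?\<beta>)) * 1"
      by (intro mult_mono mult_left_mono 1 2) auto
    finally have "(?P / ?c) powr \<gamma> / ?c\<^sup>2 \<le> (2 * sqrt \<epsilon>) powr (\<gamma> - ?\<beta>) * ?L powr (\<gamma> - ?\<beta>) * ?P powr ?\<beta>"
      by (simp add: mult_ac)
    then show ?thesis by (simp add: add_increasing)
  next
    case False
    define t where "t = 1 / ?c\<^sup>2 - 1"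
    have t0: "t \<ge> 0" using c by (simp add: t_def power_le_one)
    have "(sqrt \<epsilon> * ?L)\<^sup>2 \<le> ?P\<^sup>2" using False e L0 by (intro power_mono) auto
    then have LP: "\<epsilon> * ?L\<^sup>2 \<le> ?P\<^sup>2" using e by (simp add: power_mult_distrib)
    have "?P\<^sup>2 * t = ?y\<^sup>2" unfolding geo(3) using c by (simp add: t_def power_divide field_simps)
    also have "\<dots> \<le> \<epsilon> * (\<epsilon> * ?L\<^sup>2)" using y2 by (simp add: power2_eq_square mult_ac)
    also have "\<dots> \<le> \<epsilon> * ?P\<^sup>2" using LP e by (intro mult_left_mono) auto
    finally have te: "t \<le> \<epsilon>" using P0 by (simp add: mult.commute[of \<epsilon>])
    have c2: "1 / ?c\<^sup>2 = 1 + t" by (simp add: t_def)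
    have "?c powr (-3) \<le> 4"
    proof -
      have "?c powr (-3) = (1 / ?c\<^sup>2) powr (3/2)"
        using c by (simp add: powr_divide powr_powr powr_minus_divide flip: powr_numeral)
      also have "\<dots> \<le> 2 powr (3/2)" using te e t0 unfolding c2 by (intro powr_mono2) auto
      also have "\<dots> \<le> 2 powr 2" by (intro powr_mono) auto
      finally show ?thesis by simp
    qed
    moreover have "?c powr (- \<gamma> - 2) \<le> ?c powr (-3)" using c g by (intro powr_mono') auto
    ultimately have 3: "?c powr (- \<gamma> - 2) \<le> 4" by linarith
    have 4: "1 \<le> exp 1 * ?c powr (1 / \<epsilon>)"
    proof -
      have "?c powr (- (1 / \<epsilon>)) = (1 / ?c\<^sup>2) powr (1 / (2 * \<epsilon>))"
        using c by (simp add: powr_divide powr_powr powr_minus_divide flip: powr_numeral)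
      also have "\<dots> \<le> exp \<epsilon> powr (1 / (2 * \<epsilon>))"
      proof -
        have "1 + t \<le> exp \<epsilon>" using te exp_ge_add_one_self[of \<epsilon>] by linarith
        then show ?thesis unfolding c2 using t0 e by (intro powr_mono2) auto
      qed
      also have "\<dots> = exp (1/2)" using e by (simp add: exp_powr_real)
      also have "\<dots> \<le> exp 1" by simp
      finally show ?thesis using c by (simp add: powr_minus field_simps)
    qed
    have "(?P / ?c) powr \<gamma> / ?c\<^sup>2 = ?P powr \<gamma> * ?c powr (- \<gamma> - 2)"
      by (rule powr_split_exponents(1)[OF P0 c(1)])
    also have "\<dots> \<le> ?P powr \<gamma> * (4 * (exp 1 * ?c powr (1 / \<epsilon>)))"
      using 3 4 by (intro mult_left_mono order.trans[OF 3]) auto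
    finally have "(?P / ?c) powr \<gamma> / ?c\<^sup>2 \<le> 4 * exp 1 * ?P powr \<gamma> * ?c powr (1 / \<epsilon>)" by (simp add: mult_ac)
    then show ?thesis by (simp add: add_increasing2)
  qed
  have "(?P / ?c) powr \<gamma> / ?c\<^sup>2 * (?L powr k / ?J powr k) * (?E * ?E) \<le>
     (4 * exp 1 * ?P powr \<gamma> * ?c powr (1 / \<epsilon>)
      + (2 * sqrt \<epsilon>) powr (\<gamma> - ?\<beta>) * ?L powr (\<gamma> - ?\<beta>) * ?P powr ?\<beta>) * 2 powr k * (?E * 1)"
    by (intro mult_mono core r mult_left_mono) (auto intro!: add_nonneg_nonneg)
  also have "\<dots> = (2 powr k * 4 * exp 1 * ?P powr \<gamma> * ?c powr (1 / \<epsilon>)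
        + 2 powr k * (2 * sqrt \<epsilon>) powr (\<gamma> - ?\<beta>) * ?L powr (\<gamma> - ?\<beta>) * ?P powr ?\<beta>) * ?E"
    by (simp add: algebra_simps)
  finally show ?thesis unfolding collision_integrand_transformed[OF s c(1) p] .
qed

section \<open>Bounds for the collision integral\<close>

lemma collision_integral_bound:
  fixes \<gamma> :: real
  assumes g: "-3 < \<gamma>" "\<gamma> \<le> 1"
  obtains c where "c > 0" "\<And>k. k > max 3 (3 + \<gamma>) \<Longrightarrow> \<exists>C>0. \<forall>v.
      (\<integral>\<^sup>+ w. \<integral>\<^sup>+ \<sigma>. ennreal (collision_integrand \<gamma> k v w \<sigma>) \<partial>sphere_measure \<partial>lborel)
      \<le> ennreal (c / k powr ((\<gamma> + 3) / 4) * japanese v powr \<gamma> + C * japanese v powr (\<gamma> - 2))"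
proof -
  obtain K where K: "K > 0" and KI:
    "\<And>(F :: real^3 \<Rightarrow> real^3 \<Rightarrow> real) v a1 a2 a3 m.
      \<lbrakk>case_prod F \<in> borel_measurable (borel \<Otimes>\<^sub>M borel); \<And>w \<sigma>. 0 \<le> F w \<sigma>;
       0 \<le> a1; 0 \<le> a2; 0 \<le> a3; 0 \<le> m;
       \<And>p \<sigma>. \<lbrakk>norm \<sigma> = 1; 0 < sgn p \<bullet> \<sigma>; sgn p \<bullet> \<sigma> \<le> 1; p \<noteq> 0\<rbrakk> \<Longrightarrow>
         F (v - rel_velocity \<sigma> p) \<sigma> / (sgn p \<bullet> \<sigma>)\<^sup>2 \<le>
         (a1 * norm p powr \<gamma> * (sgn p \<bullet> \<sigma>) powr m + a2 * norm p powr (sing_exp \<gamma>) + a3 * norm p powr \<gamma>)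
           * exp (- (1/4) * (norm (v - p))\<^sup>2)\<rbrakk> \<Longrightarrow>
      (\<integral>\<^sup>+ w. \<integral>\<^sup>+ \<sigma>. ennreal (F w \<sigma>) \<partial>sphere_measure \<partial>lborel)
        \<le> ennreal (K * ((a1 / (m + 1) + a3) * japanese v powr \<gamma> + a2 * japanese v powr (sing_exp \<gamma>)))"
    using collision_integral_le[OF g(1) sing_exp_props(1)[OF g(1)]] by metis
  define K0 :: real where "K0 = 8 powr (3/2) * exp 1"
  have K0: "K0 > 0" by (simp add: K0_def)
  show thesis
  proof (rule that[of "8 * K * K0"])
    show "8 * K * K0 > 0" using K K0 by simp
    fix k :: real assume k: "k > max 3 (3 + \<gamma>)"
    obtain C where C: "C > 0" "\<And>v p \<sigma> :: real^3. \<lbrakk>norm \<sigma> = 1; 0 < sgn p \<bullet> \<sigma>; sgn p \<bullet> \<sigma> \<le> 1; p \<noteq> 0\<rbrakk> \<Longrightarrow>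
      collision_integrand \<gamma> k v (v - rel_velocity \<sigma> p) \<sigma> / (sgn p \<bullet> \<sigma>)\<^sup>2 \<le>
      (8 powr (3/2) * exp 1 * norm p powr \<gamma> * (sgn p \<bullet> \<sigma>) powr ((k - 3) / 8)
        + C * japanese v powr (\<gamma> - 2 - sing_exp \<gamma>) * norm p powr (sing_exp \<gamma>))
      * exp (- (1/4) * (norm (v - p))\<^sup>2)"
      using collision_integrand_pointwise[OF g k] by metis
    have "(\<integral>\<^sup>+ w. \<integral>\<^sup>+ \<sigma>. ennreal (collision_integrand \<gamma> k v w \<sigma>) \<partial>sphere_measure \<partial>lborel)
      \<le> ennreal (8 * K * K0 / k powr ((\<gamma> + 3) / 4) * japanese v powr \<gamma> + (K * C) * japanese v powr (\<gamma> - 2))" for v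
    proof -
      let ?L = "japanese v"
      have "(\<integral>\<^sup>+ w. \<integral>\<^sup>+ \<sigma>. ennreal (collision_integrand \<gamma> k v w \<sigma>) \<partial>sphere_measure \<partial>lborel)
        \<le> ennreal (K * ((K0 / ((k - 3) / 8 + 1) + 0) * ?L powr \<gamma> + C * ?L powr (\<gamma> - 2 - sing_exp \<gamma>) * ?L powr (sing_exp \<gamma>)))"
      proof (rule KI)
        fix p \<sigma> :: "real^3"
        assume "norm \<sigma> = 1" "0 < sgn p \<bullet> \<sigma>" "sgn p \<bullet> \<sigma> \<le> 1" "p \<noteq> 0"
        from C(2)[OF this, of v]
        show "collision_integrand \<gamma> k v (v - rel_velocity \<sigma> p) \<sigma> / (sgn p \<bullet> \<sigma>)\<^sup>2 \<le>
          (K0 * norm p powr \<gamma> * (sgn p \<bullet> \<sigma>) powr ((k - 3) / 8)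
            + C * ?L powr (\<gamma> - 2 - sing_exp \<gamma>) * norm p powr (sing_exp \<gamma>) + 0 * norm p powr \<gamma>)
          * exp (- (1/4) * (norm (v - p))\<^sup>2)" by (simp add: K0_def)
      qed (use K0 C(1) k in \<open>auto simp: collision_integrand_nonneg collision_integrand_measurable\<close>)
      also have "\<dots> \<le> ennreal (8 * K * K0 / k powr ((\<gamma> + 3) / 4) * ?L powr \<gamma> + (K * C) * ?L powr (\<gamma> - 2))"
      proof (rule ennreal_leI)
        have "k powr ((\<gamma> + 3) / 4) \<le> k powr 1" using k g by (intro powr_mono) auto
        then have "k powr ((\<gamma> + 3) / 4) \<le> k + 5" using k by simp
        moreover have "k powr ((\<gamma> + 3) / 4) > 0" using k by simp
        ultimately have "8 * K0 / (k + 5) \<le> 8 * K0 / k powr ((\<gamma> + 3) / 4)"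
          using K0 k by (intro divide_left_mono) auto
        moreover have "K0 / ((k - 3) / 8 + 1) = 8 * K0 / (k + 5)" using k by (simp add: field_simps)
        ultimately have 1: "K0 / ((k - 3) / 8 + 1) \<le> 8 * K0 / k powr ((\<gamma> + 3) / 4)" by simp
        have 2: "?L powr (\<gamma> - 2 - sing_exp \<gamma>) * ?L powr (sing_exp \<gamma>) = ?L powr (\<gamma> - 2)"
          by (simp flip: powr_add)
        have "K * ((K0 / ((k - 3) / 8 + 1) + 0) * ?L powr \<gamma> + C * ?L powr (\<gamma> - 2 - sing_exp \<gamma>) * ?L powr (sing_exp \<gamma>))
          \<le> K * (8 * K0 / k powr ((\<gamma> + 3) / 4) * ?L powr \<gamma> + C * ?L powr (\<gamma> - 2))"
          unfolding mult.assoc 2 using 1 K by (intro mult_left_mono add_mono mult_right_mono) auto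
        then show "K * ((K0 / ((k - 3) / 8 + 1) + 0) * ?L powr \<gamma> + C * ?L powr (\<gamma> - 2 - sing_exp \<gamma>) * ?L powr (sing_exp \<gamma>))
          \<le> 8 * K * K0 / k powr ((\<gamma> + 3) / 4) * ?L powr \<gamma> + (K * C) * ?L powr (\<gamma> - 2)"
          by (simp add: algebra_simps)
      qed
      finally show ?thesis .
    qed
    moreover have "K * C > 0" using K C(1) by simp
    ultimately show "\<exists>C>0. \<forall>v.
      (\<integral>\<^sup>+ w. \<integral>\<^sup>+ \<sigma>. ennreal (collision_integrand \<gamma> k v w \<sigma>) \<partial>sphere_measure \<partial>lborel)
      \<le> ennreal (8 * K * K0 / k powr ((\<gamma> + 3) / 4) * japanese v powr \<gamma> + C * japanese v powr (\<gamma> - 2))"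
      by blast
  qed
qed

lemma collision_integral_bound_crude:
  fixes \<gamma> k :: real
  assumes g: "-3 < \<gamma>" "\<gamma> \<le> 1" and k: "k > max 3 (3 + \<gamma>)"
  obtains D where "D > 0" "\<And>v. (\<integral>\<^sup>+ w. \<integral>\<^sup>+ \<sigma>. ennreal (collision_integrand \<gamma> k v w \<sigma>) \<partial>sphere_measure \<partial>lborel)
      \<le> ennreal (D * japanese v powr \<gamma>)"
proof -
  obtain c where c: "c > 0" "\<And>k. k > max 3 (3 + \<gamma>) \<Longrightarrow> \<exists>C>0. \<forall>v.
      (\<integral>\<^sup>+ w. \<integral>\<^sup>+ \<sigma>. ennreal (collision_integrand \<gamma> k v w \<sigma>) \<partial>sphere_measure \<partial>lborel)
      \<le> ennreal (c / k powr ((\<gamma> + 3) / 4) * japanese v powr \<gamma> + C * japanese v powr (\<gamma> - 2))"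
    using collision_integral_bound[OF g] by metis
  obtain C where C: "C > 0" "\<And>v. (\<integral>\<^sup>+ w. \<integral>\<^sup>+ \<sigma>. ennreal (collision_integrand \<gamma> k v w \<sigma>) \<partial>sphere_measure \<partial>lborel)
      \<le> ennreal (c / k powr ((\<gamma> + 3) / 4) * japanese v powr \<gamma> + C * japanese v powr (\<gamma> - 2))"
    using c(2)[OF k] by blast
  show thesis
  proof (rule that)
    show "c / k powr ((\<gamma> + 3) / 4) + C > 0" using c C k by (intro add_pos_pos) auto
    fix v :: "real^3"
    have "japanese v powr (\<gamma> - 2) \<le> japanese v powr \<gamma>" by (intro powr_mono japanese_ge_1) auto
    then have "C * japanese v powr (\<gamma> - 2) \<le> C * japanese v powr \<gamma>" using C by (intro mult_left_mono) auto
    then show "(\<integral>\<^sup>+ w. \<integral>\<^sup>+ \<sigma>. ennreal (collision_integrand \<gamma> k v w \<sigma>) \<partial>sphere_measure \<partial>lborel)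
      \<le> ennreal ((c / k powr ((\<gamma> + 3) / 4) + C) * japanese v powr \<gamma>)"
      by (intro order.trans[OF C(2)] ennreal_leI) (simp add: algebra_simps)
  qed
qed

text \<open>
  A jump larger than \<open>\<langle>v\<rangle> / \<epsilon>\<close> makes \<open>\<langle>v'\<rangle>\<close> at least \<open>\<langle>v\<rangle> (1 / \<epsilon> - 1) \<ge> \<langle>v\<rangle> / (2 \<epsilon>)\<close>, so each unit of the
  exponent that is given up yields a factor \<open>2 \<epsilon>\<close>.
\<close>
lemma large_deflection_le:
  assumes e: "0 < \<epsilon>" "\<epsilon> \<le> 1/2" and k: "k' \<le> k"
    and large: "norm (v - post v w \<sigma>) > japanese v / \<epsilon>"
  shows "collision_integrand \<gamma> k v w \<sigma> \<le> (2 * \<epsilon>) powr (k - k') * collision_integrand \<gamma> k' v w \<sigma>"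
proof -
  let ?L = "japanese v" and ?J = "japanese (post v w \<sigma>)"
  have L: "?L > 0" and J: "?J > 0" by (rule japanese_pos)+
  have "norm (v - post v w \<sigma>) \<le> norm v + norm (post v w \<sigma>)" by (rule norm_triangle_ineq4)
  then have "?L / \<epsilon> \<le> ?L + ?J" using large norm_le_japanese[of v] norm_le_japanese[of "post v w \<sigma>"] by linarith
  then have "?L \<le> (?L + ?J) * \<epsilon>" using e by (simp add: field_simps)
  moreover have "?L * \<epsilon> \<le> ?L * (1/2)" using e L by (intro mult_left_mono) auto
  ultimately have "?L \<le> 2 * \<epsilon> * ?J" by (simp add: algebra_simps)
  then have "?L / ?J \<le> 2 * \<epsilon>" using J by (simp add: field_simps)
  then have "(?L / ?J) powr (k - k') \<le> (2 * \<epsilon>) powr (k - k')" using L J k by (intro powr_mono2) auto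
  moreover have "?L powr k / ?J powr k = (?L / ?J) powr (k - k') * (?L powr k' / ?J powr k')"
    using L J by (simp add: powr_divide powr_diff)
  moreover have "0 \<le> ?L powr k' / ?J powr k'" by simp
  ultimately have "?L powr k / ?J powr k \<le> (2 * \<epsilon>) powr (k - k') * (?L powr k' / ?J powr k')"
    by (metis mult_right_mono)
  then have "norm (v - w) powr \<gamma> * (?L powr k / ?J powr k) * exp (- (1/2) * (norm (post_star v w \<sigma>))\<^sup>2)
    \<le> norm (v - w) powr \<gamma> * ((2 * \<epsilon>) powr (k - k') * (?L powr k' / ?J powr k')) * exp (- (1/2) * (norm (post_star v w \<sigma>))\<^sup>2)"
    by (intro mult_right_mono mult_left_mono) auto
  then show ?thesis unfolding collision_integrand_def by (simp only: mult_ac)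
qed

text \<open>
  Restricting to \<open>\<epsilon> \<le> 1/2\<close> keeps \<open>\<langle>v'\<rangle>\<close> comparable to \<open>\<langle>v\<rangle>\<close> for small deflections and of order at least
  \<open>\<langle>v\<rangle> / \<epsilon>\<close> for large ones.
\<close>
lemma extreme_deflection_bound:
  fixes \<gamma> k :: real
  assumes g: "-3 < \<gamma>" "\<gamma> \<le> 1" and k: "k > max 3 (3 + \<gamma>)"
  obtains C :: "real \<Rightarrow> real" where "(C \<longlongrightarrow> 0) (at_right 0)"
    "\<And>\<epsilon> v. 0 < \<epsilon> \<Longrightarrow> \<epsilon> \<le> 1/2 \<Longrightarrow>
      (\<integral>\<^sup>+ w. \<integral>\<^sup>+ \<sigma>. ennreal (indicator ({\<sigma>. norm (v - post v w \<sigma>) > japanese v / \<epsilon>}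
                                \<union> {\<sigma>. norm (v - post v w \<sigma>) < \<epsilon> * japanese v}) \<sigma> * collision_integrand \<gamma> k v w \<sigma>)
        \<partial>sphere_measure \<partial>lborel) \<le> ennreal (C \<epsilon> * japanese v powr \<gamma>)"
proof -
  note b = sing_exp_props[OF g(1)]
  obtain K where K: "K > 0" and KI:
    "\<And>(F :: real^3 \<Rightarrow> real^3 \<Rightarrow> real) v a1 a2 a3 m.
      \<lbrakk>case_prod F \<in> borel_measurable (borel \<Otimes>\<^sub>M borel); \<And>w \<sigma>. 0 \<le> F w \<sigma>;
       0 \<le> a1; 0 \<le> a2; 0 \<le> a3; 0 \<le> m;
       \<And>p \<sigma>. \<lbrakk>norm \<sigma> = 1; 0 < sgn p \<bullet> \<sigma>; sgn p \<bullet> \<sigma> \<le> 1; p \<noteq> 0\<rbrakk> \<Longrightarrow>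
         F (v - rel_velocity \<sigma> p) \<sigma> / (sgn p \<bullet> \<sigma>)\<^sup>2 \<le>
         (a1 * norm p powr \<gamma> * (sgn p \<bullet> \<sigma>) powr m + a2 * norm p powr (sing_exp \<gamma>) + a3 * norm p powr \<gamma>)
           * exp (- (1/4) * (norm (v - p))\<^sup>2)\<rbrakk> \<Longrightarrow>
      (\<integral>\<^sup>+ w. \<integral>\<^sup>+ \<sigma>. ennreal (F w \<sigma>) \<partial>sphere_measure \<partial>lborel)
        \<le> ennreal (K * ((a1 / (m + 1) + a3) * japanese v powr \<gamma> + a2 * japanese v powr (sing_exp \<gamma>)))"
    using collision_integral_le[OF g(1) b(1)] by metis
  \<comment> \<open>An admissible exponent strictly below \<open>k\<close>: the gap \<open>k - k'\<close> is the power of \<open>\<epsilon>\<close> gained for large deflections.\<close>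
  define k' where "k' = (k + max 3 (3 + \<gamma>)) / 2"
  have k': "k' > max 3 (3 + \<gamma>)" "k' < k" using k by (auto simp: k'_def)
  define K0 :: real where "K0 = 8 powr (3/2) * exp 1"
  have K0: "K0 > 0" by (simp add: K0_def)
  obtain D where D: "D > 0" "\<And>v p \<sigma> :: real^3. \<lbrakk>norm \<sigma> = 1; 0 < sgn p \<bullet> \<sigma>; sgn p \<bullet> \<sigma> \<le> 1; p \<noteq> 0\<rbrakk> \<Longrightarrow>
      collision_integrand \<gamma> k' v (v - rel_velocity \<sigma> p) \<sigma> / (sgn p \<bullet> \<sigma>)\<^sup>2 \<le>
      (8 powr (3/2) * exp 1 * norm p powr \<gamma> * (sgn p \<bullet> \<sigma>) powr ((k' - 3) / 8)
        + D * japanese v powr (\<gamma> - 2 - sing_exp \<gamma>) * norm p powr (sing_exp \<gamma>))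
      * exp (- (1/4) * (norm (v - p))\<^sup>2)"
    using collision_integrand_pointwise[OF g k'(1)] by metis
  define a1 where "a1 = 2 powr k * 4 * exp (1::real)"
  define s where "s \<epsilon> = 2 powr k * (2 * sqrt \<epsilon>) powr (\<gamma> - sing_exp \<gamma>)" for \<epsilon> :: real
  define r where "r \<epsilon> = (2 * \<epsilon>) powr (k - k')" for \<epsilon> :: real
  define C where "C \<epsilon> = K * ((a1 / (1 / \<epsilon> + 1) + r \<epsilon> * K0) + (s \<epsilon> + r \<epsilon> * D))" for \<epsilon>
  have s0: "s \<epsilon> \<ge> 0" and r0: "r \<epsilon> \<ge> 0" for \<epsilon> by (auto simp: s_def r_def)
  have a10: "a1 \<ge> 0" by (simp add: a1_def)
  show thesis
  proof (rule that[of C])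
    have "\<gamma> - sing_exp \<gamma> > 0" "k - k' > 0" using b k' by auto
    have pos: "\<forall>\<^sub>F \<epsilon> in at_right 0. \<epsilon> > (0::real)" by (rule eventually_at_right_less)
    have id0: "((\<lambda>\<epsilon>. \<epsilon>) \<longlongrightarrow> (0::real)) (at_right 0)" by (rule tendsto_ident_at)
    have lim1: "((\<lambda>\<epsilon>. (2 * sqrt \<epsilon>) powr (\<gamma> - sing_exp \<gamma>)) \<longlongrightarrow> 0) (at_right 0)"
    proof (rule tendsto_zero_powrI[OF _ tendsto_const])
      show "((\<lambda>\<epsilon>. 2 * sqrt \<epsilon>) \<longlongrightarrow> 0) (at_right 0)"
        using tendsto_mult_left[OF tendsto_real_sqrt[OF id0], of 2] by simp
      show "\<forall>\<^sub>F \<epsilon> in at_right 0. 0 \<le> 2 * sqrt \<epsilon>" using pos by eventually_elim simp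
    qed fact
    have lim2: "((\<lambda>\<epsilon>. (2 * \<epsilon>) powr (k - k')) \<longlongrightarrow> 0) (at_right 0)"
    proof (rule tendsto_zero_powrI[OF _ tendsto_const])
      show "((\<lambda>\<epsilon>. 2 * \<epsilon>) \<longlongrightarrow> 0) (at_right (0::real))"
        using tendsto_mult_left[OF id0, of 2] by simp
      show "\<forall>\<^sub>F \<epsilon> in at_right 0. 0 \<le> 2 * (\<epsilon>::real)" using pos by eventually_elim simp
    qed fact
    have lim3: "((\<lambda>\<epsilon>. a1 / (1 / \<epsilon> + 1)) \<longlongrightarrow> 0) (at_right 0)"
    proof (rule Lim_transform_eventually)
      have "((\<lambda>\<epsilon>. a1 * \<epsilon> / (1 + \<epsilon>)) \<longlongrightarrow> a1 * 0 / (1 + 0)) (at_right 0)"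
        by (intro tendsto_intros id0) simp
      then show "((\<lambda>\<epsilon>. a1 * \<epsilon> / (1 + \<epsilon>)) \<longlongrightarrow> 0) (at_right 0)" by simp
      show "\<forall>\<^sub>F \<epsilon> in at_right 0. a1 * \<epsilon> / (1 + \<epsilon>) = a1 / (1 / \<epsilon> + 1)"
        using pos by eventually_elim (simp add: field_simps)
    qed
    from lim1 lim2 lim3 have "(C \<longlongrightarrow> K * ((0 + 0 * K0) + (2 powr k * 0 + 0 * D))) (at_right 0)"
      unfolding C_def s_def r_def by (intro tendsto_intros)
    then show "(C \<longlongrightarrow> 0) (at_right 0)" by simp
  next
    fix \<epsilon> :: real and v :: "real^3"
    assume e: "0 < \<epsilon>" "\<epsilon> \<le> 1/2"
    let ?L = "japanese v"
    let ?F = "\<lambda>w \<sigma>. indicator ({\<sigma>. norm (v - post v w \<sigma>) > ?L / \<epsilon>}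
                                \<union> {\<sigma>. norm (v - post v w \<sigma>) < \<epsilon> * ?L}) \<sigma> * collision_integrand \<gamma> k v w \<sigma>"
    have Fif: "?F = (\<lambda>w \<sigma>. if norm (v - post v w \<sigma>) > ?L / \<epsilon> \<or> norm (v - post v w \<sigma>) < \<epsilon> * ?L
        then collision_integrand \<gamma> k v w \<sigma> else 0)"
      by (auto simp: fun_eq_iff indicator_def)
    have L1: "?L powr (\<gamma> - 2 - sing_exp \<gamma>) \<le> ?L powr (\<gamma> - sing_exp \<gamma>)" by (intro powr_mono japanese_ge_1) auto
    have "(\<integral>\<^sup>+ w. \<integral>\<^sup>+ \<sigma>. ennreal (?F w \<sigma>) \<partial>sphere_measure \<partial>lborel)
       \<le> ennreal (K * ((a1 / (1 / \<epsilon> + 1) + r \<epsilon> * K0) * ?L powr \<gamma>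
            + ((s \<epsilon> + r \<epsilon> * D) * ?L powr (\<gamma> - sing_exp \<gamma>)) * ?L powr (sing_exp \<gamma>)))"
    proof (rule KI)
      show "case_prod ?F \<in> borel_measurable (borel \<Otimes>\<^sub>M borel)"
        unfolding Fif post_def by measurable
      fix p \<sigma> :: "real^3"
      assume asm: "norm \<sigma> = 1" "0 < sgn p \<bullet> \<sigma>" "sgn p \<bullet> \<sigma> \<le> 1" "p \<noteq> 0"
      let ?w = "v - rel_velocity \<sigma> p" and ?c = "sgn p \<bullet> \<sigma>" and ?E = "exp (- (1/4) * (norm (v - p))\<^sup>2)"
      let ?y = "norm (v - post v ?w \<sigma>)"
      let ?A = "a1 * norm p powr \<gamma> * ?c powr (1 / \<epsilon>)"
      let ?B = "(s \<epsilon> + r \<epsilon> * D) * ?L powr (\<gamma> - sing_exp \<gamma>) * norm p powr (sing_exp \<gamma>)"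
      let ?G = "r \<epsilon> * K0 * norm p powr \<gamma>"
      have A0: "?A \<ge> 0" and B0: "?B \<ge> 0" and G0: "?G \<ge> 0" and E0: "?E \<ge> 0"
        using s0[of \<epsilon>] r0[of \<epsilon>] a10 K0 D(1) by auto
      consider "?y < \<epsilon> * ?L" | "?y > ?L / \<epsilon>" | "?F ?w \<sigma> = 0" unfolding Fif by fastforce
      then show "?F ?w \<sigma> / ?c\<^sup>2 \<le> (?A + ?B + ?G) * ?E"
      proof cases
        case 1
        then have "?F ?w \<sigma> / ?c\<^sup>2 = collision_integrand \<gamma> k v ?w \<sigma> / ?c\<^sup>2" by simp
        also have "\<dots> \<le> (?A + s \<epsilon> * ?L powr (\<gamma> - sing_exp \<gamma>) * norm p powr (sing_exp \<gamma>)) * ?E"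
          using small_deflection_pointwise[OF g _ e asm 1, of k] k unfolding a1_def s_def by simp
        also have "\<dots> \<le> (?A + ?B + ?G) * ?E"
        proof (intro mult_right_mono E0)
          have "0 \<le> r \<epsilon> * D * ?L powr (\<gamma> - sing_exp \<gamma>) * norm p powr (sing_exp \<gamma>)" using r0 D by simp
          then show "?A + s \<epsilon> * ?L powr (\<gamma> - sing_exp \<gamma>) * norm p powr (sing_exp \<gamma>) \<le> ?A + ?B + ?G"
            using G0 by (simp add: distrib_right)
        qed
        finally show ?thesis .
      next
        case 2
        have "?F ?w \<sigma> / ?c\<^sup>2 = collision_integrand \<gamma> k v ?w \<sigma> / ?c\<^sup>2" using 2 by simp
        also have "\<dots> \<le> r \<epsilon> * collision_integrand \<gamma> k' v ?w \<sigma> / ?c\<^sup>2"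
          using large_deflection_le[OF e _ 2, of k' k] k' unfolding r_def by (intro divide_right_mono) auto
        also have "\<dots> = r \<epsilon> * (collision_integrand \<gamma> k' v ?w \<sigma> / ?c\<^sup>2)" by simp
        also have "\<dots> \<le> r \<epsilon> * ((K0 * norm p powr \<gamma> * ?c powr ((k' - 3) / 8)
            + D * ?L powr (\<gamma> - 2 - sing_exp \<gamma>) * norm p powr (sing_exp \<gamma>)) * ?E)"
          using D(2)[OF asm, of v] unfolding K0_def by (intro mult_left_mono r0)
        also have "\<dots> \<le> r \<epsilon> * ((K0 * norm p powr \<gamma> * 1
            + D * ?L powr (\<gamma> - sing_exp \<gamma>) * norm p powr (sing_exp \<gamma>)) * ?E)"
          using asm k' K0 D(1) powr_mono'[of 0 "(k' - 3) / 8" ?c] L1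
          by (intro mult_left_mono r0 mult_right_mono E0 add_mono) auto
        also have "\<dots> = (?G + r \<epsilon> * D * ?L powr (\<gamma> - sing_exp \<gamma>) * norm p powr (sing_exp \<gamma>)) * ?E"
          by (simp add: algebra_simps)
        also have "\<dots> \<le> (?A + ?B + ?G) * ?E"
        proof (intro mult_right_mono E0)
          have "0 \<le> s \<epsilon> * ?L powr (\<gamma> - sing_exp \<gamma>) * norm p powr (sing_exp \<gamma>)" using s0 by simp
          then show "?G + r \<epsilon> * D * ?L powr (\<gamma> - sing_exp \<gamma>) * norm p powr (sing_exp \<gamma>) \<le> ?A + ?B + ?G"
            using A0 by (simp add: distrib_right)
        qed
        finally show ?thesis .
      next
        case 3
        have "0 \<le> (?A + ?B + ?G) * ?E"
          by (intro mult_nonneg_nonneg add_nonneg_nonneg A0 B0 G0 E0)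
        then show ?thesis unfolding 3 by simp
      qed
    qed (use e s0[of \<epsilon>] r0[of \<epsilon>] a10 K0 D(1) in \<open>auto simp: collision_integrand_nonneg\<close>)
    also have "K * ((a1 / (1 / \<epsilon> + 1) + r \<epsilon> * K0) * ?L powr \<gamma>
            + ((s \<epsilon> + r \<epsilon> * D) * ?L powr (\<gamma> - sing_exp \<gamma>)) * ?L powr (sing_exp \<gamma>)) = C \<epsilon> * ?L powr \<gamma>"
    proof -
      have "?L powr (\<gamma> - sing_exp \<gamma>) * ?L powr (sing_exp \<gamma>) = ?L powr \<gamma>" by (simp flip: powr_add)
      then show ?thesis unfolding C_def mult.assoc by (simp add: algebra_simps)
    qed
    finally show "(\<integral>\<^sup>+ w. \<integral>\<^sup>+ \<sigma>. ennreal (?F w \<sigma>) \<partial>sphere_measure \<partial>lborel) \<le> ennreal (C \<epsilon> * ?L powr \<gamma>)" .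
  qed
qed

theorem lemma6p2:
  fixes \<gamma> :: real
  assumes "-3 < \<gamma>" and "\<gamma> \<le> 1"
  shows "\<exists>c>0. \<forall>k::real. k > max 3 (3 + \<gamma>) \<longrightarrow>
    (\<exists>C>0. \<forall>v::real^3.
      (\<integral>\<^sup>+ w. \<integral>\<^sup>+ \<sigma>.
          ennreal (norm (v - w) powr \<gamma>
            * (japanese v powr k / japanese (post v w \<sigma>) powr k)
            * exp (- (1/2) * (norm (post_star v w \<sigma>))\<^sup>2))
        \<partial>sphere_measure \<partial>lborel)
      \<le> ennreal (c / k powr ((\<gamma> + 3) / 4) * japanese v powr \<gamma> + C * japanese v powr (\<gamma> - 2)))
    \<and> (\<exists>C :: real \<Rightarrow> real. (C \<longlongrightarrow> 0) (at_right 0) \<and>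
      (\<forall>\<epsilon>. 0 < \<epsilon> \<and> \<epsilon> < 1 \<longrightarrow> (\<forall>v::real^3.
        (\<integral>\<^sup>+ w. \<integral>\<^sup>+ \<sigma>.
            ennreal (indicator ({\<sigma>. norm (v - post v w \<sigma>) > japanese v / \<epsilon>}
                                \<union> {\<sigma>. norm (v - post v w \<sigma>) < \<epsilon> * japanese v}) \<sigma>
              * norm (v - w) powr \<gamma>
              * (japanese v powr k / japanese (post v w \<sigma>) powr k)
              * exp (- (1/2) * (norm (post_star v w \<sigma>))\<^sup>2))
          \<partial>sphere_measure \<partial>lborel)
        \<le> ennreal (C \<epsilon> * japanese v powr \<gamma>))))
    \<and> (\<exists>C>0. \<forall>v::real^3.
      (\<integral>\<^sup>+ w. \<integral>\<^sup>+ \<sigma>.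
          ennreal (norm (v - w) powr \<gamma>
            * (japanese v powr k / japanese (post v w \<sigma>) powr k)
            * exp (- (1/2) * (norm (post_star v w \<sigma>))\<^sup>2)
            * japanese (post v w \<sigma>) powr (-2))
        \<partial>sphere_measure \<partial>lborel)
      \<le> ennreal (C * japanese v powr (\<gamma> - 2)))"
proof -
  obtain c where c: "c > 0" and main: "\<And>k. k > max 3 (3 + \<gamma>) \<Longrightarrow> \<exists>C>0. \<forall>v.
      (\<integral>\<^sup>+ w. \<integral>\<^sup>+ \<sigma>. ennreal (collision_integrand \<gamma> k v w \<sigma>) \<partial>sphere_measure \<partial>lborel)
      \<le> ennreal (c / k powr ((\<gamma> + 3) / 4) * japanese v powr \<gamma> + C * japanese v powr (\<gamma> - 2))"
    using collision_integral_bound[OF assms] by metis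
  show ?thesis
  proof (rule exI[of _ c], intro conjI allI impI c)
    fix k :: real assume k: "k > max 3 (3 + \<gamma>)"
    show "\<exists>C>0. \<forall>v::real^3.
      (\<integral>\<^sup>+ w. \<integral>\<^sup>+ \<sigma>.
          ennreal (norm (v - w) powr \<gamma>
            * (japanese v powr k / japanese (post v w \<sigma>) powr k)
            * exp (- (1/2) * (norm (post_star v w \<sigma>))\<^sup>2))
        \<partial>sphere_measure \<partial>lborel)
      \<le> ennreal (c / k powr ((\<gamma> + 3) / 4) * japanese v powr \<gamma> + C * japanese v powr (\<gamma> - 2))"
      using main[OF k] unfolding collision_integrand_def .
    obtain D where D: "D > 0" "\<And>v. (\<integral>\<^sup>+ w. \<integral>\<^sup>+ \<sigma>. ennreal (collision_integrand \<gamma> k v w \<sigma>) \<partial>sphere_measure \<partial>lborel)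
      \<le> ennreal (D * japanese v powr \<gamma>)"
      using collision_integral_bound_crude[OF assms k] by metis
    obtain C :: "real \<Rightarrow> real" where C: "(C \<longlongrightarrow> 0) (at_right 0)"
      "\<And>\<epsilon> v. 0 < \<epsilon> \<Longrightarrow> \<epsilon> \<le> 1/2 \<Longrightarrow>
      (\<integral>\<^sup>+ w. \<integral>\<^sup>+ \<sigma>. ennreal (indicator ({\<sigma>. norm (v - post v w \<sigma>) > japanese v / \<epsilon>}
                                \<union> {\<sigma>. norm (v - post v w \<sigma>) < \<epsilon> * japanese v}) \<sigma> * collision_integrand \<gamma> k v w \<sigma>)
        \<partial>sphere_measure \<partial>lborel) \<le> ennreal (C \<epsilon> * japanese v powr \<gamma>)"
      using extreme_deflection_bound[OF assms k] by blast
    \<comment> \<open>For \<open>\<epsilon>\<close> away from zero the bound for the full integral is good enough.\<close>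
    let ?C = "\<lambda>\<epsilon>. if \<epsilon> \<le> 1/2 then C \<epsilon> else D"
    have "\<forall>\<^sub>F \<epsilon> in at_right (0::real). \<epsilon> < 1/2"
      by (rule eventually_at_rightI[of 0 "1/2"]) auto
    then have "\<forall>\<^sub>F \<epsilon> in at_right 0. C \<epsilon> = ?C \<epsilon>" by eventually_elim simp
    then have lim: "(?C \<longlongrightarrow> 0) (at_right 0)" using C(1) by (rule Lim_transform_eventually[rotated])
    have "(\<integral>\<^sup>+ w. \<integral>\<^sup>+ \<sigma>.
            ennreal (indicator ({\<sigma>. norm (v - post v w \<sigma>) > japanese v / \<epsilon>}
                                \<union> {\<sigma>. norm (v - post v w \<sigma>) < \<epsilon> * japanese v}) \<sigma> * collision_integrand \<gamma> k v w \<sigma>)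
          \<partial>sphere_measure \<partial>lborel)
        \<le> ennreal (?C \<epsilon> * japanese v powr \<gamma>)" if "0 < \<epsilon> \<and> \<epsilon> < 1" for \<epsilon> v
    proof (cases "\<epsilon> \<le> 1/2")
      case True
      then show ?thesis using C(2)[of \<epsilon> v] that by simp
    next
      case False
      have "(\<integral>\<^sup>+ w. \<integral>\<^sup>+ \<sigma>.
            ennreal (indicator ({\<sigma>. norm (v - post v w \<sigma>) > japanese v / \<epsilon>}
                                \<union> {\<sigma>. norm (v - post v w \<sigma>) < \<epsilon> * japanese v}) \<sigma> * collision_integrand \<gamma> k v w \<sigma>)
          \<partial>sphere_measure \<partial>lborel) \<le> (\<integral>\<^sup>+ w. \<integral>\<^sup>+ \<sigma>. ennreal (collision_integrand \<gamma> k v w \<sigma>) \<partial>sphere_measure \<partial>lborel)"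
        by (intro nn_integral_mono ennreal_leI) (auto simp: indicator_def collision_integrand_nonneg)
      then show ?thesis using D(2)[of v] False by (auto intro: order.trans)
    qed
    then show "\<exists>C :: real \<Rightarrow> real. (C \<longlongrightarrow> 0) (at_right 0) \<and>
      (\<forall>\<epsilon>. 0 < \<epsilon> \<and> \<epsilon> < 1 \<longrightarrow> (\<forall>v::real^3.
        (\<integral>\<^sup>+ w. \<integral>\<^sup>+ \<sigma>.
            ennreal (indicator ({\<sigma>. norm (v - post v w \<sigma>) > japanese v / \<epsilon>}
                                \<union> {\<sigma>. norm (v - post v w \<sigma>) < \<epsilon> * japanese v}) \<sigma>
              * norm (v - w) powr \<gamma>
              * (japanese v powr k / japanese (post v w \<sigma>) powr k)
              * exp (- (1/2) * (norm (post_star v w \<sigma>))\<^sup>2))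
          \<partial>sphere_measure \<partial>lborel)
        \<le> ennreal (C \<epsilon> * japanese v powr \<gamma>)))"
      using lim unfolding collision_integrand_def mult.assoc by (intro exI[of _ ?C]) blast
    \<comment> \<open>The extra factor \<open>\<langle>v'\<rangle>\<^bsup>-2\<^esup>\<close> raises the exponent of the weight to \<open>k + 2\<close> at the price of \<open>\<langle>v\<rangle>\<^bsup>-2\<^esup>\<close>.\<close>
    have k2: "k + 2 > max 3 (3 + \<gamma>)" using k by simp
    obtain D2 where D2: "D2 > 0" "\<And>v. (\<integral>\<^sup>+ w. \<integral>\<^sup>+ \<sigma>. ennreal (collision_integrand \<gamma> (k + 2) v w \<sigma>) \<partial>sphere_measure \<partial>lborel)
      \<le> ennreal (D2 * japanese v powr \<gamma>)"
      using collision_integral_bound_crude[OF assms k2] by metis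
    have "(\<integral>\<^sup>+ w. \<integral>\<^sup>+ \<sigma>. ennreal (collision_integrand \<gamma> k v w \<sigma> * japanese (post v w \<sigma>) powr (-2)) \<partial>sphere_measure \<partial>lborel)
      \<le> ennreal (D2 * japanese v powr (\<gamma> - 2))" for v
    proof -
      let ?L = "japanese v"
      have eq: "collision_integrand \<gamma> k v w \<sigma> * japanese (post v w \<sigma>) powr (-2) = ?L powr (-2) * collision_integrand \<gamma> (k + 2) v w \<sigma>" for w \<sigma>
        using japanese_pos[of v] japanese_pos[of "post v w \<sigma>"]
        by (simp add: collision_integrand_def powr_add powr_minus field_simps)
      have m1: "(\<lambda>\<sigma>. ennreal (collision_integrand \<gamma> (k + 2) v w \<sigma>)) \<in> borel_measurable sphere_measure" for w
        unfolding measurable_cong_sets[OF sets_sphere_measure refl]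
        by (rule measurable_restrict_space1) measurable
      have "(\<integral>\<^sup>+ w. \<integral>\<^sup>+ \<sigma>. ennreal (collision_integrand \<gamma> k v w \<sigma> * japanese (post v w \<sigma>) powr (-2)) \<partial>sphere_measure \<partial>lborel)
         = (\<integral>\<^sup>+ w. ennreal (?L powr (-2)) * (\<integral>\<^sup>+ \<sigma>. ennreal (collision_integrand \<gamma> (k + 2) v w \<sigma>) \<partial>sphere_measure) \<partial>lborel)"
        unfolding eq by (intro nn_integral_cong) (simp add: ennreal_mult collision_integrand_nonneg nn_integral_cmult m1)
      also have "\<dots> = ennreal (?L powr (-2)) * (\<integral>\<^sup>+ w. \<integral>\<^sup>+ \<sigma>. ennreal (collision_integrand \<gamma> (k + 2) v w \<sigma>) \<partial>sphere_measure \<partial>lborel)"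
        by (rule nn_integral_cmult) (subst nn_integral_sphere_measure; measurable)
      also have "\<dots> \<le> ennreal (?L powr (-2)) * ennreal (D2 * ?L powr \<gamma>)"
        by (intro mult_left_mono D2(2)) simp
      also have "\<dots> = ennreal (D2 * ?L powr (\<gamma> - 2))"
        using D2(1) by (simp add: powr_diff powr_minus field_simps flip: ennreal_mult)
      finally show ?thesis .
    qed
    then show "\<exists>C>0. \<forall>v::real^3.
      (\<integral>\<^sup>+ w. \<integral>\<^sup>+ \<sigma>.
          ennreal (norm (v - w) powr \<gamma>
            * (japanese v powr k / japanese (post v w \<sigma>) powr k)
            * exp (- (1/2) * (norm (post_star v w \<sigma>))\<^sup>2)
            * japanese (post v w \<sigma>) powr (-2))
        \<partial>sphere_measure \<partial>lborel)
      \<le> ennreal (C * japanese v powr (\<gamma> - 2))"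
      using D2(1) unfolding collision_integrand_def by blast
  qed
qed

end
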